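(* Let $\mathbf{Y}[t] = \mathbf{X}^{\star}[t] + \boldsymbol\varepsilon[t]$, $t=1,\dots,n$, where each $\mathbf{X}^{\star}[t]\in\mathbb{R}^p$ is deterministic and the $\boldsymbol\varepsilon[t]\sim\mathcal{N}(0,\sigma^2 I_{p\times p})$ are independent. Let $\tau^{\star}\subset\{1,\dots,n\}$ be the set of change-points, i.e. $t\in\tau^\star \Leftrightarrow \mathbf{X}^\star[t]\neq\mathbf{X}^\star[t+1]$. Let $\Delta_{\min}=\min_{t\in\tau^\star}\|\mathbf{X}^\star[t]-\mathbf{X}^\star[t+1]\|_2$, let $T_{\min}=\min_{t_i,t_j\in\tau^\star,\,t_i\neq t_j}|t_i-t_j|$, and let $\mathcal{X}=\{\mathbf{X}^\star[1],\dots,\mathbf{X}^\star[n]\}$. Suppose that for some $r>1$ and some convex set $\mathcal{C}\subset\mathbb{R}^p$ containing the origin in its interior, $$\Delta_{\min}^2\,T_{\min}\ \geq\ 64\,\sigma^2\,\{\eta_{\mathcal{C}}(\mathcal{X})+r\sqrt{2\log n}\}^2,$$ and that $T_{\min}/4\le t\le n-T_{\min}/4$ for all $t\in\tau^\star$. Suppose the change-point estimation algorithm described in the context is applied with the set $\mathcal{C}$ and with any choice of parameters $\theta,\gamma,\lambda$ satisfying 1. $T_{\min}/4\geq\theta$; 2. $\Delta_{\min}/2\ \geq\ \gamma\ \geq\ 2\frac{\sigma}{\sqrt{\theta}}\{\eta_{\mathcal{C}}(\mathcal{X})+r\sqrt{2\log n}\}$; 3. $\lambda=\frac{\sigma}{\sqrt\theta}\,\arg\min_{\tilde\lambda\ge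 0}\ \max_{\mathbf{X}^\star[t]\in\mathcal{X}}\ \mathbb{E}_{\mathbf{g}\sim\mathcal{N}(0,I_{p\times p})}\big[\mathrm{dist}(\mathbf{g},\tilde\lambda\cdot\partial\|\mathbf{X}^\star[t]\|_{\mathcal{C}})\big]$. Then, with probability greater than $1-5n^{1-r^2}$, the output $\hat\tau$ of the algorithm satisfies both 1. $|\hat\tau|=|\tau^\star|$, and 2. $|\hat t_i-t_i^\star|\ \leq\ \min\Big\{\Big(\frac{4r\sqrt{\log n}}{\eta_{\mathcal{C}}(\mathcal{X})}+4\Big)\frac{\sigma\,\eta_{\mathcal{C}}(\mathcal{X})}{\Delta_{\min}}\sqrt{\theta},\ \theta\Big\}$ for all $i$, where $\hat t_i$ and $t_i^\star$ are the $i$-th elements of $\hat\tau$ and $\tau^\star$ when ordered increasingly.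
   Context: Conventions. $\sigma>0$; $\theta$ is a positive integer; $\tau^\star$ is understood to be such that $T_{\min}$ is defined (at least two change-points); only indices $t\le n-1$ can be change-points. Gauge. For a convex set $\mathcal{C}\subset\mathbb{R}^p$ with the origin in its interior, $\|\mathbf{X}\|_{\mathcal{C}}:=\inf\{t>0:\mathbf{X}\in t\mathcal{C}\}$, a finite convex function. $\partial\|\mathbf{X}\|_{\mathcal{C}}$ is the subdifferential of $\|\cdot\|_{\mathcal{C}}$ at $\mathbf{X}$. For a set $K\subset\mathbb{R}^p$, $\mathrm{dist}(\mathbf{g},K)=\inf_{\mathbf{w}\in K}\|\mathbf{w}-\mathbf{g}\|_2$. Gaussian distance of a collection: $$\eta_{\mathcal{C}}(\mathcal{X}):=\inf_{\lambda\ge0}\ \max_{\mathbf{X}^\star[t]\in\mathcal{X}}\ \mathbb{E}_{\mathbf{g}\sim\mathcal{N}(0,I_{p\times p})}\big[\mathrm{dist}(\mathbf{g},\lambda\cdot\partial\|\mathbf{X}^\star[t]\|_{\mathcal{C}})\big].$$ Algorithm (input $\{\mathbf{Y}[t]\}_{t=1}^n$, parameters $\theta,\gamma,\lambda$, set $\mathcal{C}$): (Filtering) $\bar{\mathbf{Y}}[i]=\frac1\theta\sum_{t=i}^{i+\theta-1}\mathbf{Y}[t]$ for $1\le i\le n-\theta+1$. (Denoising) $\hat{\mathbf{X}}[t]=\arg\min_{\mathbf{X}\in\mathbb{R}^p}\frac12\|\bar{\mathbf{Y}}[t]-\mathbf{X}\|_2^2+\lambda\|\mathbf{X}\|_{\mathcal{C}}$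 for $1\le t\le n-\theta+1$. (Differencing) $S[t]:=\|\hat{\mathbf{X}}[t+1]-\hat{\mathbf{X}}[t-\theta+1]\|_2$ for $\theta\le t\le n-\theta$. (Thresholding) For all $t$ with $S[t]<\gamma$, set $S[t]=0$. (Output) Partition the indices $t$ with $S[t]\ne0$ into groups: two consecutive (in increasing order) such indices belong to the same group if and only if they are at most $\theta$ apart. From each group select the index $\hat t$ with the largest value of $S$; $\hat\tau$ is the set of selected indices. *)

theory Defs
  imports "HOL-Probability.Probability"
begin

definition iso_normal_density :: "real \<Rightarrow> real ^ 'p \<Rightarrow> real" where
  "iso_normal_density \<sigma> x = (\<Prod>i\<in>UNIV. normal_density 0 \<sigma> (x $ i))"

definition std_gaussian :: "(real ^ 'p) measure" where
  "std_gaussian = density lborel (\<lambda>x. ennreal (iso_normal_density 1 x))"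

definition minkowski_gauge :: "'a::real_vector set \<Rightarrow> 'a \<Rightarrow> real" where
  "minkowski_gauge C x = Inf {t. t > 0 \<and> x \<in> (\<lambda>c. t *\<^sub>R c) ` C}"

definition subdifferential :: "('a::real_inner \<Rightarrow> real) \<Rightarrow> 'a \<Rightarrow> 'a set" where
  "subdifferential f x = {v. \<forall>y. f y \<ge> f x + v \<bullet> (y - x)}"

definition max_gaussian_dist :: "(real ^ 'p) set \<Rightarrow> (real ^ 'p) set \<Rightarrow> real \<Rightarrow> real" where
  "max_gaussian_dist C \<X> l =
     Max ((\<lambda>x. \<integral>g. infdist g ((\<lambda>v. l *\<^sub>R v) ` subdifferential (minkowski_gauge C) x)
              \<partial>std_gaussian) ` \<X>)"

definition gaussian_dist :: "(real ^ 'p) set \<Rightarrow> (real ^ 'p) set \<Rightarrow> real" where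
  "gaussian_dist C \<X> = (INF l\<in>{0..}. max_gaussian_dist C \<X> l)"

definition change_points :: "nat \<Rightarrow> (nat \<Rightarrow> 'a) \<Rightarrow> nat set" where
  "change_points n X = {t. 1 \<le> t \<and> t < n \<and> X t \<noteq> X (t + 1)}"

text \<open>The minimum jump is meaningful only for at least one change-point, the minimum
  spacing only for at least two.\<close>

definition min_jump :: "nat \<Rightarrow> (nat \<Rightarrow> 'a::real_normed_vector) \<Rightarrow> real" where
  "min_jump n X = Min ((\<lambda>t. norm (X t - X (t + 1))) ` change_points n X)"

definition min_spacing :: "nat \<Rightarrow> (nat \<Rightarrow> 'a) \<Rightarrow> real" where
  "min_spacing n X = Min {\<bar>real s - real t\<bar> | s t.
     s \<in> change_points n X \<and> t \<in> change_points n X \<and> s \<noteq> t}"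

definition filtered :: "nat \<Rightarrow> (nat \<Rightarrow> real ^ 'p) \<Rightarrow> nat \<Rightarrow> real ^ 'p" where
  "filtered \<theta> y i = (1 / real \<theta>) *\<^sub>R (\<Sum>t = i..i + \<theta> - 1. y t)"

text \<open>For \<open>\<lambda> \<ge> 0\<close> the objective is strongly convex and continuous, so the minimiser is unique.\<close>

definition denoise :: "(real ^ 'p) set \<Rightarrow> real \<Rightarrow> real ^ 'p \<Rightarrow> real ^ 'p" where
  "denoise C lam z =
     arg_min (\<lambda>x. 1 / 2 * (norm (z - x))\<^sup>2 + lam * minkowski_gauge C x) (\<lambda>x. True)"

text \<open>Only used for \<open>\<theta> \<le> t \<le> n - \<theta>\<close>, where the subtraction does not truncate.\<close>

definition diff_stat :: "(real ^ 'p) set \<Rightarrow> nat \<Rightarrow> real \<Rightarrow> (nat \<Rightarrow> real ^ 'p) \<Rightarrow> nat \<Rightarrow> real" where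
  "diff_stat C \<theta> lam y t =
     norm (denoise C lam (filtered \<theta> y (t + 1)) - denoise C lam (filtered \<theta> y (t - \<theta> + 1)))"

definition thresholded :: "real \<Rightarrow> (nat \<Rightarrow> real) \<Rightarrow> nat \<Rightarrow> real" where
  "thresholded \<gamma> S t = (if S t < \<gamma> then 0 else S t)"

definition nonzero_indices :: "nat \<Rightarrow> nat \<Rightarrow> (nat \<Rightarrow> real) \<Rightarrow> nat set" where
  "nonzero_indices n \<theta> S = {t. \<theta> \<le> t \<and> t \<le> n - \<theta> \<and> S t \<noteq> 0}"

definition close_consecutive :: "nat \<Rightarrow> nat set \<Rightarrow> (nat \<times> nat) set" where
  "close_consecutive \<theta> A =
     {(s, t). s \<in> A \<and> t \<in> A \<and> s < t \<and> (\<forall>u\<in>A. \<not> (s < u \<and> u < t)) \<and> t - s \<le> \<theta>}"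

definition index_groups :: "nat \<Rightarrow> nat set \<Rightarrow> nat set set" where
  "index_groups \<theta> A = A // (close_consecutive \<theta> A \<union> (close_consecutive \<theta> A)\<inverse>)\<^sup>*"

text \<open>The maximiser of a group need not be unique; the output is therefore a relation that
  holds for every way of breaking ties.\<close>

definition is_selection :: "(nat \<Rightarrow> real) \<Rightarrow> nat set set \<Rightarrow> nat set \<Rightarrow> bool" where
  "is_selection S G T \<longleftrightarrow>
     (\<exists>sel. (\<forall>g\<in>G. is_arg_max S (\<lambda>t. t \<in> g) (sel g)) \<and> T = sel ` G)"

definition is_algorithm_output ::
  "nat \<Rightarrow> (real ^ 'p) set \<Rightarrow> nat \<Rightarrow> real \<Rightarrow> real \<Rightarrow> (nat \<Rightarrow> real ^ 'p) \<Rightarrow> nat set \<Rightarrow> bool" where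
  "is_algorithm_output n C \<theta> \<gamma> lam y T \<longleftrightarrow>
     (let S = thresholded \<gamma> (diff_stat C \<theta> lam y)
      in is_selection S (index_groups \<theta> (nonzero_indices n \<theta> S)) T)"

lemma is_algorithm_output_exists: "\<exists>T. is_algorithm_output n C \<theta> \<gamma> lam y T"
proof -
  define S where "S = thresholded \<gamma> (diff_stat C \<theta> lam y)"
  define A where "A = nonzero_indices n \<theta> S"
  define R where "R = close_consecutive \<theta> A \<union> (close_consecutive \<theta> A)\<inverse>"
  have fin: "finite A"
    by (rule finite_subset[of _ "{..n - \<theta>}"]) (auto simp: A_def nonzero_indices_def)
  have sub: "b \<in> A" if "(a, b) \<in> R\<^sup>*" "a \<in> A" for a b
    using that by (induction rule: rtrancl_induct) (auto simp: R_def close_consecutive_def)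
  have "\<exists>t. is_arg_max S (\<lambda>t. t \<in> g) t" if "g \<in> index_groups \<theta> A" for g
  proof -
    from that obtain x where x: "x \<in> A" "g = R\<^sup>* `` {x}"
      unfolding index_groups_def R_def[symmetric] by (auto simp: quotient_def)
    have "finite g" "g \<noteq> {}"
      using x sub fin by (auto intro: finite_subset[of _ A])
    then have "Max (S ` g) \<in> S ` g" by (intro Max_in) auto
    then obtain t where "t \<in> g" "S t = Max (S ` g)" by auto
    with \<open>finite g\<close> have "is_arg_max S (\<lambda>t. t \<in> g) t"
      by (auto simp: is_arg_max_def not_less intro: Max_ge)
    then show ?thesis ..
  qed
  then obtain sel where "\<forall>g\<in>index_groups \<theta> A. is_arg_max S (\<lambda>t. t \<in> g) (sel g)" by metis
  then show ?thesis
    unfolding is_algorithm_output_def is_selection_def Let_def S_def[symmetric] A_def[symmetric]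
    by blast
qed

end

theory Submission
  imports Defs "HOL-Real_Asymp.Real_Asymp"
begin

text \<open>
  The proximal map \<open>denoise\<close> is nonexpansive, and its error at \<open>x\<close> under a perturbation \<open>z\<close> is at most
  the distance of \<open>z\<close> to \<open>\<lambda> \<partial>\<parallel>x\<parallel>\<close>. For a window of pure noise this distance is a Lipschitz function of a
  standard Gaussian vector, scaled by \<open>c = \<sigma> / \<surd>\<theta>\<close>, with mean at most \<open>c \<eta>\<close>. The two windows entering
  \<open>S[t]\<close> are disjoint, so their two errors are independent and their sum exceeds \<open>2 c (\<eta> + u)\<close> with
  probability at most \<open>exp (- u\<^sup>2)\<close>; the choice \<open>u = r \<surd>(ln n)\<close> and a union bound over \<open>t\<close> leave a good
  event of probability more than \<open>1 - n\<^bsup>1 - r\<^sup>2\<^esup>\<close>. On it, \<open>S[t]\<close> is below the threshold away from the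
  change-points and above it at each of them, so the groups are the neighbourhoods of the
  change-points. At distance \<open>\<delta> < \<theta>\<close> from a change-point with jump \<open>D\<close>, nonexpansiveness gives
  \<open>S[t] \<le> (1 - \<delta> / \<theta>) D + 2 c (\<eta> + u)\<close>, while \<open>S \<ge> D - 2 c (\<eta> + u)\<close> at the change-point itself; comparing
  the two bounds \<open>\<delta>\<close> for the maximiser.

  The sharp Gaussian concentration inequality comes from the dual form of Talagrand's transport
  inequality: if \<open>h x - f y \<le> \<parallel>x - y\<parallel>\<^sup>2 / 2\<close> for all \<open>x, y\<close> then \<open>\<integral> exp h d\<gamma> \<le> exp (\<integral> f d\<gamma>)\<close>. It is proved on the
  line by monotone transport and tensorises by integrating out one coordinate at a time.
\<close>

subsection \<open>Gaussian concentration\<close>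

text \<open>Completing the square turns the tilt of the normal density by \<open>exp (l * x)\<close>
  into a multiple of the normal density centred at \<open>l\<close>, and
  \<open>exp (L * \<bar>x\<bar>)\<close> is at most the sum of the tilts by \<open>L\<close> and
  \<open>- L\<close>. This is the dominating function for Lipschitz functions and their
  exponentials.\<close>

lemma integrable_normal_exp_abs:
  "integrable lborel (\<lambda>x. std_normal_density x * exp (c + L * \<bar>x\<bar>))"
proof -
  have shift: "integrable lborel (\<lambda>x. std_normal_density x * exp (l * x))" for l
  proof -
    have "std_normal_density x * exp (l * x) = exp (l\<^sup>2 / 2) * normal_density l 1 x" for x
      by (simp add: normal_density_def field_simps power2_eq_square flip: exp_add)
    then show ?thesis by simp
  qed
  have "integrable lborel (\<lambda>x. exp c * (std_normal_density x * exp (L * x) + std_normal_density x * exp ((- L) * x)))"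
    by (intro integrable_mult_right Bochner_Integration.integrable_add shift)
  then show ?thesis
  proof (rule Bochner_Integration.integrable_bound)
    show "AE x in lborel. norm (std_normal_density x * exp (c + L * \<bar>x\<bar>))
        \<le> norm (exp c * (std_normal_density x * exp (L * x) + std_normal_density x * exp ((- L) * x)))"
    proof (rule AE_I2)
      fix x :: real
      have "exp (L * \<bar>x\<bar>) \<le> exp (L * x) + exp ((- L) * x)"
        by (cases "x \<ge> 0") (auto simp: add_increasing add_increasing2)
      then have "std_normal_density x * exp c * exp (L * \<bar>x\<bar>)
          \<le> std_normal_density x * exp c * (exp (L * x) + exp ((- L) * x))"
        by (intro mult_left_mono) auto
      then show "norm (std_normal_density x * exp (c + L * \<bar>x\<bar>))
        \<le> norm (exp c * (std_normal_density x * exp (L * x) + std_normal_density x * exp ((- L) * x)))"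
        by (simp add: abs_mult exp_add algebra_simps)
    qed
  qed auto
qed

text \<open>The half-line is cut at \<open>x - 1\<close>: the left piece is a constant, and the
  fundamental theorem of calculus on the compact interval \<open>{x - 1..x + 1}\<close>, which has
  \<open>x\<close> in its interior, handles the remainder.\<close>

lemma has_real_derivative_lborel_cdf:
  fixes g :: "real \<Rightarrow> real"
  assumes cont: "continuous_on UNIV g" and int: "integrable lborel g"
  shows "((\<lambda>x. \<integral>y. indicator {..x} y * g y \<partial>lborel) has_real_derivative g x) (at x)"
proof -
  define A where "A = (\<lambda>x. \<integral>y. indicator {..x} y * g y \<partial>lborel)"
  have intS: "integrable lborel (\<lambda>y. indicator S y * g y)" if "S \<in> sets borel" for S
    using integrable_mult_indicator[OF _ int, of S] that by simp
  have diff: "A b = A (x - 1) + integral {x - 1..b} g" if "b \<in> {x - 1..x + 1}" for b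
  proof -
    have "A b = (\<integral>y. indicator {..x - 1} y * g y + indicator {x - 1<..b} y * g y \<partial>lborel)"
      unfolding A_def using that by (intro Bochner_Integration.integral_cong) (auto split: split_indicator)
    also have "\<dots> = A (x - 1) + (\<integral>y. indicator {x - 1<..b} y * g y \<partial>lborel)"
      unfolding A_def by (intro Bochner_Integration.integral_add intS) auto
    also have "(\<integral>y. indicator {x - 1<..b} y * g y \<partial>lborel) = (\<integral>y. indicator {x - 1..b} y * g y \<partial>lborel)"
    proof (rule Bochner_Integration.integral_cong_AE)
      show "AE y in lborel. indicator {x - 1<..b} y * g y = indicator {x - 1..b} y * g y"
        using AE_lborel_singleton[of "x - 1"] by eventually_elim (auto split: split_indicator)
    qed (intro borel_measurable_integrable intS; simp)+
    also have "\<dots> = integral {x - 1..b} g"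
    proof -
      have "set_integrable lborel {x - 1..b} g"
        using intS[of "{x - 1..b}"] by (simp add: set_integrable_def)
      from set_borel_integral_eq_integral(2)[OF this]
      show ?thesis by (simp add: set_lebesgue_integral_def)
    qed
    finally show ?thesis .
  qed
  have "((\<lambda>b. integral {x - 1..b} g) has_real_derivative g x) (at x within {x - 1..x + 1})"
    by (rule integral_has_real_derivative) (auto intro: continuous_on_subset[OF cont])
  then have "((\<lambda>b. A (x - 1) + integral {x - 1..b} g) has_real_derivative g x) (at x within {x - 1..x + 1})"
    by (rule DERIV_add[OF DERIV_const, simplified])
  then have "(A has_real_derivative g x) (at x within {x - 1..x + 1})"
    by (rule has_field_derivative_transform_within[where d = 1]) (simp_all only: diff, auto)
  moreover have "at x within {x - 1..x + 1} = at x"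
    by (rule at_within_Icc_at) auto
  ultimately show ?thesis unfolding A_def by simp
qed

lemma tendsto_lborel_cdf_at_top:
  fixes g :: "real \<Rightarrow> real"
  assumes int: "integrable lborel g"
  shows "((\<lambda>x. \<integral>y. indicator {..x} y * g y \<partial>lborel) \<longlongrightarrow> (\<integral>y. g y \<partial>lborel)) at_top"
  using tendsto_integral_at_top[OF _ int] by simp

lemma tendsto_lborel_cdf_at_bot:
  fixes g :: "real \<Rightarrow> real"
  assumes int: "integrable lborel g"
  shows "((\<lambda>x. \<integral>y. indicator {..x} y * g y \<partial>lborel) \<longlongrightarrow> 0) at_bot"
  unfolding filterlim_at_bot_mirror
proof (rule tendsto_at_topI_sequentially)
  fix X :: "nat \<Rightarrow> real" assume X: "filterlim X at_top sequentially"
  have [measurable]: "g \<in> borel_measurable borel"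
    using borel_measurable_integrable[OF int] by simp
  have "(\<lambda>n. \<integral>y. indicator {..- X n} y * g y \<partial>lborel) \<longlonglongrightarrow> (\<integral>y. 0 \<partial>(lborel :: real measure))"
  proof (rule integral_dominated_convergence)
    show "integrable lborel (\<lambda>x. norm (g x))" using int by simp
    show "AE x in lborel. (\<lambda>n. indicator {..- X n} x * g x) \<longlonglongrightarrow> 0"
    proof (rule AE_I2)
      fix x :: real
      have "eventually (\<lambda>n. - x < X n) sequentially"
        using X unfolding filterlim_at_top_dense by blast
      then have "\<forall>\<^sub>F n in sequentially. indicator {..- X n} x * g x = 0"
        by eventually_elim simp
      then show "(\<lambda>n. indicator {..- X n} x * g x) \<longlonglongrightarrow> 0"
        by (rule tendsto_eventually)
    qed
    show "AE x in lborel. norm (indicator {..- X n} x * g x) \<le> norm (g x)" for n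
      by (auto split: split_indicator)
  qed auto
  then show "(\<lambda>n. \<integral>y. indicator {..- X n} y * g y \<partial>lborel) \<longlonglongrightarrow> 0" by simp
qed

lemma real_lipschitz_continuous_on:
  fixes h :: "real \<Rightarrow> real"
  assumes "\<And>x y. \<bar>h x - h y\<bar> \<le> L * \<bar>x - y\<bar>"
  shows "continuous_on UNIV h"
proof -
  have "L \<ge> 0" using assms[of 0 1] by auto
  then have "L-lipschitz_on UNIV h"
    using assms by (intro lipschitz_onI) (auto simp: dist_real_def)
  then show ?thesis by (rule lipschitz_on_continuous_on)
qed

lemma has_real_derivative_std_normal_density:
  "(std_normal_density has_real_derivative - x * std_normal_density x) (at x)"
proof -
  have "((\<lambda>x. 1 / sqrt (2 * pi) * exp (- x\<^sup>2 / 2)) has_real_derivative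
      1 / sqrt (2 * pi) * (exp (- x\<^sup>2 / 2) * (- x))) (at x)"
    by (rule DERIV_cmult) (auto intro!: derivative_eq_intros)
  then show ?thesis
    by (simp add: std_normal_density_def[abs_def] mult.assoc mult.commute)
qed

lemma std_normal_density_at_top: "(std_normal_density \<longlongrightarrow> 0) at_top"
proof -
  have "((\<lambda>x::real. exp (- x\<^sup>2 / 2)) \<longlongrightarrow> 0) at_top" by real_asymp
  from tendsto_mult_left[OF this, of "1 / sqrt (2 * pi)"]
  show ?thesis by (simp add: std_normal_density_def[abs_def])
qed

lemma std_normal_density_at_bot: "(std_normal_density \<longlongrightarrow> 0) at_bot"
  using std_normal_density_at_top
  by (simp add: filterlim_at_bot_mirror std_normal_density_def[abs_def])

section \<open>Monotone transport in one dimension\<close>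

text \<open>Since \<open>w\<close> is nonincreasing, the derivative can change sign only from plus
  to minus. Hence \<open>D\<close> is nondecreasing on the whole half-line left of \<open>x\<close>
  or nonincreasing on the whole half-line right of it, and in either case \<open>D x\<close> is at
  least a limit equal to 0.\<close>

lemma nonneg_if_derivative_changes_sign_once:
  fixes D D' w v :: "real \<Rightarrow> real"
  assumes der: "\<And>x. (D has_real_derivative (w x - Z) * v x) (at x)"
    and v: "\<And>x. v x \<ge> 0" and w: "antimono w"
    and lim: "(D \<longlongrightarrow> 0) at_bot" "(D \<longlongrightarrow> 0) at_top"
  shows "D x \<ge> 0"
proof (cases "w x \<ge> Z")
  case True
  have "D y \<le> D x" if "y \<le> x" for y
  proof (rule DERIV_nonneg_imp_nondecreasing[OF that])
    fix z assume "z \<le> x"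
    then have "w x \<le> w z" using w by (auto simp: antimono_def)
    then show "\<exists>d. (D has_real_derivative d) (at z) \<and> d \<ge> 0"
      using der[of z] v[of z] True by (intro exI[of _ "(w z - Z) * v z"]) auto
  qed
  then show ?thesis
    by (intro tendsto_upperbound[OF lim(1)] eventually_mono[OF eventually_le_at_bot[of x]]) auto
next
  case False
  have "D y \<le> D x" if "x \<le> y" for y
  proof (rule DERIV_nonpos_imp_nonincreasing[OF that])
    fix z assume "x \<le> z"
    then have "w z \<le> w x" using w by (auto simp: antimono_def)
    then show "\<exists>d. (D has_real_derivative d) (at z) \<and> d \<le> 0"
      using der[of z] v[of z] False by (intro exI[of _ "(w z - Z) * v z"]) (auto simp: mult_nonpos_nonneg)
  qed
  then show ?thesis
    by (intro tendsto_upperbound[OF lim(2)] eventually_mono[OF eventually_ge_at_top[of x]]) auto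
qed

text \<open>
  Let \<open>T\<close> be the increasing map transporting \<open>\<gamma>\<close> to \<open>Z\<^sup>-\<^sup>1 e\<^sup>h \<gamma>\<close>. Taking logarithms in the change of variables
  formula and using \<open>ln T' \<le> T' - 1\<close> gives \<open>ln Z - f x \<le> x (x - T x) - (1 - T' x)\<close>, whose right-hand side
  times the density is minus the derivative of \<open>G x = (x - T x) \<phi> x\<close>. Comparison with \<open>\<gamma>\<close> shifted by \<open>\<plusminus>L\<close>
  yields \<open>\<bar>T x - x\<bar> \<le> L\<close>, so \<open>G\<close> vanishes at infinity.
\<close>

lemma gaussian_infconv_real:
  fixes h f :: "real \<Rightarrow> real"
  assumes hL: "\<And>x y. \<bar>h x - h y\<bar> \<le> L * \<bar>x - y\<bar>"
    and fL: "\<And>x y. \<bar>f x - f y\<bar> \<le> L * \<bar>x - y\<bar>"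
    and hf: "\<And>x y. h x - f y \<le> (x - y)\<^sup>2 / 2"
  shows "(\<integral>x. std_normal_density x * exp (h x) \<partial>lborel) \<le> exp (\<integral>x. std_normal_density x * f x \<partial>lborel)"
proof -
  let ?\<phi> = std_normal_density
  have L0: "L \<ge> 0" using hL[of 0 1] by auto
  have ch: "continuous_on UNIV h" and cf: "continuous_on UNIV f"
    by (rule real_lipschitz_continuous_on; fact)+
  have c\<phi>: "continuous_on UNIV ?\<phi>"
    unfolding std_normal_density_def[abs_def] by (intro continuous_intros) auto
  have bnd: "\<bar>k x\<bar> \<le> \<bar>k 0\<bar> + L * \<bar>x\<bar>" if "\<And>x y. \<bar>k x - k y\<bar> \<le> L * \<bar>x - y\<bar>" for k :: "real \<Rightarrow> real" and x
    using that[of x 0] by auto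
  define n where "n x = ?\<phi> x * exp (h x)" for x
  have n_pos: "n x > 0" for x by (simp add: n_def normal_density_pos)
  have cn: "continuous_on UNIV n"
    unfolding n_def[abs_def] by (intro continuous_intros c\<phi> ch)
  have int_n: "integrable lborel n"
  proof (rule Bochner_Integration.integrable_bound[OF integrable_normal_exp_abs[of "\<bar>h 0\<bar>" L]])
    show "n \<in> borel_measurable lborel"
      using borel_measurable_continuous_onI[OF cn] by simp
    show "AE x in lborel. norm (n x) \<le> norm (?\<phi> x * exp (\<bar>h 0\<bar> + L * \<bar>x\<bar>))"
    proof (rule AE_I2)
      fix x show "norm (n x) \<le> norm (?\<phi> x * exp (\<bar>h 0\<bar> + L * \<bar>x\<bar>))"
        using bnd[of h x, OF hL] by (auto simp: n_def abs_mult intro!: mult_left_mono)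
    qed
  qed
  have int_f: "integrable lborel (\<lambda>x. ?\<phi> x * f x)"
  proof (rule Bochner_Integration.integrable_bound[OF integrable_normal_exp_abs[of "\<bar>f 0\<bar>" L]])
    show "(\<lambda>x. ?\<phi> x * f x) \<in> borel_measurable lborel"
      using borel_measurable_continuous_onI[OF cf] by simp
    show "AE x in lborel. norm (?\<phi> x * f x) \<le> norm (?\<phi> x * exp (\<bar>f 0\<bar> + L * \<bar>x\<bar>))"
    proof (rule AE_I2)
      fix x
      have "\<bar>f x\<bar> \<le> \<bar>f 0\<bar> + L * \<bar>x\<bar>" by (rule bnd[OF fL])
      also have "\<dots> \<le> exp (\<bar>f 0\<bar> + L * \<bar>x\<bar>)" using exp_ge_add_one_self[of "\<bar>f 0\<bar> + L * \<bar>x\<bar>"] by linarith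
      finally show "norm (?\<phi> x * f x) \<le> norm (?\<phi> x * exp (\<bar>f 0\<bar> + L * \<bar>x\<bar>))"
        by (auto simp: abs_mult intro!: mult_left_mono)
    qed
  qed
  have int_\<phi>: "integrable lborel ?\<phi>" by simp
  define Z where "Z = (\<integral>x. n x \<partial>lborel)"
  define N where "N x = (\<integral>y. indicator {..x} y * n y \<partial>lborel)" for x
  define P where "P x = (\<integral>y. indicator {..x} y * ?\<phi> y \<partial>lborel)" for x
  have derN: "(N has_real_derivative n x) (at x)" for x
    unfolding N_def[abs_def] by (rule has_real_derivative_lborel_cdf[OF cn int_n])
  have derP: "(P has_real_derivative ?\<phi> x) (at x)" for x
    unfolding P_def[abs_def] by (rule has_real_derivative_lborel_cdf[OF c\<phi> int_\<phi>])
  have limN: "(N \<longlongrightarrow> 0) at_bot" "(N \<longlongrightarrow> Z) at_top"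
    unfolding N_def[abs_def] Z_def
    by (rule tendsto_lborel_cdf_at_bot[OF int_n], rule tendsto_lborel_cdf_at_top[OF int_n])
  have limP: "(P \<longlongrightarrow> 0) at_bot" "(P \<longlongrightarrow> 1) at_top"
    using tendsto_lborel_cdf_at_bot[OF int_\<phi>] tendsto_lborel_cdf_at_top[OF int_\<phi>]
    by (simp_all add: P_def[abs_def])
  have strictN: "N x < N y" if "x < y" for x y
    by (rule DERIV_pos_imp_increasing[OF that]) (use derN n_pos in blast)
  have contN: "isCont N x" for x using derN DERIV_isCont by blast
  have Zpos: "Z > 0"
  proof -
    have "0 \<le> N 0" unfolding N_def
      by (rule Bochner_Integration.integral_nonneg) (simp add: n_def)
    also have "\<dots> < N 1" by (rule strictN) simp
    also have "N 1 \<le> Z"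
      by (rule tendsto_lowerbound[OF limN(2)])
        (auto intro: less_imp_le strictN eventually_mono[OF eventually_gt_at_top[of 1]])
    finally show ?thesis .
  qed
  \<comment> \<open>The density ratio between the translated tilted measure and the Gaussian has
    exponent \<open>h (x + s) - s * x - s\<^sup>2 / 2\<close>. As \<open>h\<close> is
    \<open>L\<close>-Lipschitz, the shifts \<open>s = L\<close> and \<open>s = - L\<close> make this
    ratio monotone, which is what the sign-change lemma asks for.\<close>
  have shift: "n (x + s) = exp (h (x + s) - s * x - s\<^sup>2 / 2) * ?\<phi> x" for x s
    by (simp add: n_def std_normal_density_def power2_eq_square field_simps flip: exp_add)
  have derNs: "((\<lambda>x. N (x + s)) has_real_derivative n (x + s)) (at x)" for x s
    using DERIV_shift[of N "n (x + s)" x s] derN[of "x + s"] by (simp add: add.commute)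
  have limNs: "((\<lambda>x. N (x + s)) \<longlongrightarrow> 0) at_bot" "((\<lambda>x. N (x + s)) \<longlongrightarrow> Z) at_top" for s
  proof -
    have "filterlim (\<lambda>x. x + s) at_bot at_bot"
      unfolding filterlim_at_bot
      by (metis (mono_tags, lifting) eventually_le_at_bot eventually_mono le_diff_eq)
    then show "((\<lambda>x. N (x + s)) \<longlongrightarrow> 0) at_bot" by (rule filterlim_compose[OF limN(1)])
    have "filterlim (\<lambda>x. x + s) at_top at_top"
      unfolding filterlim_at_top
      by (metis (mono_tags, lifting) eventually_ge_at_top eventually_mono diff_le_eq)
    then show "((\<lambda>x. N (x + s)) \<longlongrightarrow> Z) at_top" by (rule filterlim_compose[OF limN(2)])
  qed
  have upper: "Z * P x \<le> N (x + L)" for x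
  proof -
    define w where "w y = exp (h (y + L) - L * y - L\<^sup>2 / 2)" for y
    have "0 \<le> N (x + L) - Z * P x"
    proof (rule nonneg_if_derivative_changes_sign_once[where D = "\<lambda>x. N (x + L) - Z * P x" and w = w and v = ?\<phi> and Z = Z])
      show "((\<lambda>x. N (x + L) - Z * P x) has_real_derivative (w x - Z) * ?\<phi> x) (at x)" for x
        by (rule DERIV_cong[OF DERIV_diff[OF derNs DERIV_cmult[OF derP]]]) (simp add: shift[of x L] w_def left_diff_distrib)
      show "antimono w"
      proof (rule antimonoI)
        fix x y :: real assume "x \<le> y"
        then show "w y \<le> w x" using hL[of "y + L" "x + L"] by (auto simp: w_def algebra_simps abs_le_iff)
      qed
      show "((\<lambda>x. N (x + L) - Z * P x) \<longlongrightarrow> 0) at_bot"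
        using tendsto_diff[OF limNs(1)[of L] tendsto_mult_left[OF limP(1), of Z]] by simp
      show "((\<lambda>x. N (x + L) - Z * P x) \<longlongrightarrow> 0) at_top"
        using tendsto_diff[OF limNs(2)[of L] tendsto_mult_left[OF limP(2), of Z]] by simp
    qed auto
    then show ?thesis by simp
  qed
  have lower: "N (x - L) \<le> Z * P x" for x
  proof -
    define w where "w y = - exp (h (y - L) + L * y - L\<^sup>2 / 2)" for y
    have "0 \<le> Z * P x - N (x + - L)"
    proof (rule nonneg_if_derivative_changes_sign_once[where D = "\<lambda>x. Z * P x - N (x + - L)" and w = w and v = ?\<phi> and Z = "- Z"])
      show "((\<lambda>x. Z * P x - N (x + - L)) has_real_derivative (w x - (- Z)) * ?\<phi> x) (at x)" for x
        by (rule DERIV_cong[OF DERIV_diff[OF DERIV_cmult[OF derP] derNs]]) (use shift[of x "- L"] in \<open>simp add: w_def left_diff_distrib\<close>)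
      show "antimono w"
      proof (rule antimonoI)
        fix x y :: real assume "x \<le> y"
        then show "w y \<le> w x" using hL[of "y - L" "x - L"] by (auto simp: w_def algebra_simps abs_le_iff)
      qed
      show "((\<lambda>x. Z * P x - N (x + - L)) \<longlongrightarrow> 0) at_bot"
        using tendsto_diff[OF tendsto_mult_left[OF limP(1), of Z] limNs(1)[of "- L"]] by simp
      show "((\<lambda>x. Z * P x - N (x + - L)) \<longlongrightarrow> 0) at_top"
        using tendsto_diff[OF tendsto_mult_left[OF limP(2), of Z] limNs(2)[of "- L"]] by simp
    qed auto
    then show ?thesis by simp
  qed
  \<comment> \<open>The two comparisons bracket \<open>Z * P x\<close> between the values of
    \<open>N\<close> at \<open>x - L\<close> and \<open>x + L\<close>, so the transport map exists
    and moves no point by more than \<open>L\<close>.\<close>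
  have "\<exists>t. x - L \<le> t \<and> t \<le> x + L \<and> N t = Z * P x" for x
    by (rule IVT) (use L0 lower upper contN in auto)
  then obtain T where T: "\<And>x. x - L \<le> T x" "\<And>x. T x \<le> x + L" "\<And>x. N (T x) = Z * P x"
    by metis
  have inj: "inj N" using strictN by (metis injI linorder_neq_iff)
  have derT: "(T has_real_derivative Z * ?\<phi> x / n (T x)) (at x)" for x
  proof -
    have gN: "inv N (N t) = t" for t using inj by simp
    have "(inv N has_real_derivative inverse (n (T x))) (at (N (T x)))"
    proof (rule DERIV_inverse_function[where f = N])
      show "N (T x - 1) < N (T x)" "N (T x) < N (T x + 1)" by (auto intro: strictN)
      show "N (inv N y) = y" if "N (T x - 1) < y" "y < N (T x + 1)" for y
      proof -
        have "\<exists>t. T x - 1 \<le> t \<and> t \<le> T x + 1 \<and> N t = y"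
          by (rule IVT) (use that contN in auto)
        then show ?thesis using gN by metis
      qed
      show "isCont (inv N) (N (T x))"
        by (rule isCont_inverse_function[of 1]) (use gN contN in auto)
    qed (use gN derN n_pos[of "T x"] in auto)
    then have "((\<lambda>x. inv N (Z * P x)) has_real_derivative inverse (n (T x)) * (Z * ?\<phi> x)) (at x)"
      unfolding T(3) by (rule DERIV_chain2) (rule DERIV_cmult[OF derP])
    moreover have "inv N (Z * P x) = T x" for x using T(3) gN by metis
    ultimately show ?thesis by (simp add: field_simps)
  qed
  define T' where "T' x = Z * ?\<phi> x / n (T x)" for x
  have T'pos: "T' x > 0" for x using Zpos n_pos by (simp add: T'_def normal_density_pos)
  have key: "ln Z - f x \<le> x * (x - T x) - (1 - T' x)" for x
  proof -
    have "ln (T' x) = ln Z + ln (?\<phi> x) - ln (?\<phi> (T x)) - h (T x)"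
      using Zpos normal_density_pos[of 1 0 x] normal_density_pos[of 1 0 "T x"]
      by (simp add: T'_def n_def ln_div ln_mult)
    moreover have "ln (?\<phi> y) = - ln (sqrt (2 * pi)) - y\<^sup>2 / 2" for y
      by (simp add: std_normal_density_def ln_mult ln_div)
    ultimately have "ln Z = ln (T' x) + x\<^sup>2 / 2 - (T x)\<^sup>2 / 2 + h (T x)" by simp
    moreover have "ln (T' x) \<le> T' x - 1" by (rule ln_le_minus_one[OF T'pos])
    moreover have "h (T x) - f x \<le> (T x - x)\<^sup>2 / 2" by (rule hf)
    moreover have "x\<^sup>2 / 2 - (T x)\<^sup>2 / 2 + (T x - x)\<^sup>2 / 2 = x * (x - T x)"
      by (simp add: power2_eq_square field_simps)
    ultimately show ?thesis by linarith
  qed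
  define G where "G x = (x - T x) * ?\<phi> x" for x
  define g where "g x = ?\<phi> x * (ln Z - f x)" for x
  have cg: "continuous_on UNIV g" unfolding g_def[abs_def] by (intro continuous_intros c\<phi> cf)
  have int_g: "integrable lborel g"
    unfolding g_def[abs_def] right_diff_distrib by (intro Bochner_Integration.integrable_diff int_f) auto
  define A where "A x = (\<integral>y. indicator {..x} y * g y \<partial>lborel)" for x
  have derA: "(A has_real_derivative g x) (at x)" for x
    unfolding A_def[abs_def] by (rule has_real_derivative_lborel_cdf[OF cg int_g])
  have derG: "(G has_real_derivative (1 - T' x) * ?\<phi> x + - x * ?\<phi> x * (x - T x)) (at x)" for x
    unfolding G_def[abs_def] T'_def
    by (intro DERIV_mult DERIV_diff DERIV_ident derT has_real_derivative_std_normal_density)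
  \<comment> \<open>By \<open>key\<close>, \<open>g\<close> is at most minus the derivative of
    \<open>G\<close>, so \<open>A + G\<close> is nonincreasing. It tends to 0 at minus infinity and
    to the integral of \<open>g\<close> at plus infinity; that integral is therefore at most 0,
    which is the claim in logarithmic form.\<close>
  have mono: "A b + G b \<le> A a + G a" if "a \<le> b" for a b
  proof (rule DERIV_nonpos_imp_nonincreasing[where f = "\<lambda>x. A x + G x", OF that])
    fix x
    have "g x \<le> ?\<phi> x * (x * (x - T x) - (1 - T' x))"
      unfolding g_def by (intro mult_left_mono key) auto
    then show "\<exists>y. ((\<lambda>x. A x + G x) has_real_derivative y) (at x) \<and> y \<le> 0"
      by (intro exI[of _ "g x + ((1 - T' x) * ?\<phi> x + - x * ?\<phi> x * (x - T x))"] conjI DERIV_add derA derG)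
         (simp add: algebra_simps)
  qed
  have boundG: "norm (G x) \<le> L * ?\<phi> x" for x
    using T(1,2)[of x] by (auto simp: G_def abs_mult intro!: mult_right_mono)
  have G_top: "(G \<longlongrightarrow> 0) at_top"
    by (rule Lim_null_comparison[of _ "\<lambda>x. L * ?\<phi> x"])
       (use boundG tendsto_mult_left[OF std_normal_density_at_top, of L] in auto)
  have G_bot: "(G \<longlongrightarrow> 0) at_bot"
    by (rule Lim_null_comparison[of _ "\<lambda>x. L * ?\<phi> x"])
       (use boundG tendsto_mult_left[OF std_normal_density_at_bot, of L] in auto)
  have A_bot: "(A \<longlongrightarrow> 0) at_bot" and A_top: "(A \<longlongrightarrow> (\<integral>x. g x \<partial>lborel)) at_top"
    unfolding A_def[abs_def]
    by (rule tendsto_lborel_cdf_at_bot[OF int_g], rule tendsto_lborel_cdf_at_top[OF int_g])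
  have "A b + G b \<le> 0" for b
  proof -
    have "((\<lambda>a. A a + G a) \<longlongrightarrow> 0 + 0) at_bot"
      by (rule tendsto_add[OF A_bot G_bot])
    moreover have "\<forall>\<^sub>F a in at_bot. A b + G b \<le> A a + G a"
      by (rule eventually_mono[OF eventually_le_at_bot[of b]]) (rule mono)
    ultimately have "A b + G b \<le> 0 + 0"
      by (rule tendsto_lowerbound) simp
    then show ?thesis by simp
  qed
  moreover have "((\<lambda>a. A a + G a) \<longlongrightarrow> (\<integral>x. g x \<partial>lborel) + 0) at_top"
    by (rule tendsto_add[OF A_top G_top])
  ultimately have "(\<integral>x. g x \<partial>lborel) + 0 \<le> 0"
    using tendsto_upperbound[where f = "\<lambda>a. A a + G a" and F = at_top and a = 0] by simp
  moreover have "(\<integral>x. g x \<partial>lborel) = ln Z - (\<integral>x. ?\<phi> x * f x \<partial>lborel)"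
    unfolding g_def[abs_def] right_diff_distrib using int_f by simp
  ultimately have "ln Z \<le> (\<integral>x. ?\<phi> x * f x \<partial>lborel)" by simp
  then have "exp (ln Z) \<le> exp (\<integral>x. ?\<phi> x * f x \<partial>lborel)" by (subst exp_le_cancel_iff)
  then have "Z \<le> exp (\<integral>x. ?\<phi> x * f x \<partial>lborel)" using Zpos by (subst (asm) exp_ln)
  then show ?thesis unfolding Z_def n_def[abs_def] .
qed

section \<open>Tensorisation to products of Gaussian measures\<close>

abbreviation gauss1 :: "real measure" where
  "gauss1 \<equiv> density lborel (\<lambda>x. ennreal (std_normal_density x))"

lemma prob_space_gauss1: "prob_space gauss1"
  by (rule prob_space_normal_density) simp

interpretation gauss1: prob_space gauss1
  by (rule prob_space_gauss1)

lemma gaussian_infconv_gauss1: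
  fixes h f :: "real \<Rightarrow> real"
  assumes hL: "\<And>x y. \<bar>h x - h y\<bar> \<le> L * \<bar>x - y\<bar>"
    and fL: "\<And>x y. \<bar>f x - f y\<bar> \<le> L * \<bar>x - y\<bar>"
    and hf: "\<And>x y. h x - f y \<le> (x - y)\<^sup>2 / 2"
  shows "(\<integral>x. exp (h x) \<partial>gauss1) \<le> exp (\<integral>x. f x \<partial>gauss1)"
proof -
  have [measurable]: "h \<in> borel_measurable borel" "f \<in> borel_measurable borel"
    by (intro borel_measurable_continuous_onI real_lipschitz_continuous_on; fact)+
  show ?thesis
    using gaussian_infconv_real[OF assms] by (simp add: integral_density)
qed

lemma integrable_gauss1_exp_abs: "integrable gauss1 (\<lambda>x. exp (L * \<bar>x\<bar>))"
  using integrable_normal_exp_abs[of 0 L] by (simp add: integrable_density)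

lemma (in prob_space) integral_exp_pos:
  assumes "integrable M (\<lambda>x. exp (k x :: real))"
  shows "0 < (\<integral>x. exp (k x) \<partial>M)"
proof -
  have "(\<integral>x. exp (k x) \<partial>M) \<noteq> 0"
    using integral_nonneg_eq_0_iff_AE[OF assms] by simp
  moreover have "0 \<le> (\<integral>x. exp (k x) \<partial>M)" by simp
  ultimately show ?thesis by linarith
qed

interpretation gaussP: product_prob_space "\<lambda>_::'i. gauss1" UNIV
  by unfold_locales

text \<open>A function that is Lipschitz for the \<open>l1\<close> norm is bounded by its value at 0
  plus \<open>L\<close> times that norm. The exponential of this bound is a product over the
  coordinates, so it is integrable factor by factor.\<close>

lemma integrable_PiM_gauss1_lipschitz:
  fixes k :: "('i \<Rightarrow> real) \<Rightarrow> real"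
  assumes I: "finite I"
    and kM: "k \<in> borel_measurable (PiM I (\<lambda>_. gauss1))"
    and kL: "\<And>x y. \<bar>k x - k y\<bar> \<le> L * (\<Sum>i\<in>I. \<bar>x i - y i\<bar>)"
  shows "integrable (PiM I (\<lambda>_. gauss1)) (\<lambda>x. exp (k x))"
    and "integrable (PiM I (\<lambda>_. gauss1)) k"
proof -
  have "integrable (PiM I (\<lambda>_. gauss1)) (\<lambda>x. exp \<bar>k (\<lambda>_. 0)\<bar> * (\<Prod>i\<in>I. exp (L * \<bar>x i\<bar>)))"
    by (intro integrable_mult_right gaussP.product_integrable_prod I integrable_gauss1_exp_abs)
  then have int: "integrable (PiM I (\<lambda>_. gauss1)) (\<lambda>x. exp (\<bar>k (\<lambda>_. 0)\<bar> + L * (\<Sum>i\<in>I. \<bar>x i\<bar>)))"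
    by (simp add: exp_add exp_sum I sum_distrib_left)
  have le: "\<bar>k x\<bar> \<le> \<bar>k (\<lambda>_. 0)\<bar> + L * (\<Sum>i\<in>I. \<bar>x i\<bar>)" for x
    using kL[of x "\<lambda>_. 0"] by simp
  show "integrable (PiM I (\<lambda>_. gauss1)) (\<lambda>x. exp (k x))"
  proof (rule Bochner_Integration.integrable_bound[OF int])
    show "AE x in PiM I (\<lambda>_. gauss1). norm (exp (k x)) \<le> norm (exp (\<bar>k (\<lambda>_. 0)\<bar> + L * (\<Sum>i\<in>I. \<bar>x i\<bar>)))"
    proof (rule AE_I2)
      fix x :: "'i \<Rightarrow> real"
      show "norm (exp (k x)) \<le> norm (exp (\<bar>k (\<lambda>_. 0)\<bar> + L * (\<Sum>i\<in>I. \<bar>x i\<bar>)))"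
        using le[of x] by simp
    qed
  qed (use kM in measurable)
  show "integrable (PiM I (\<lambda>_. gauss1)) k"
  proof (rule Bochner_Integration.integrable_bound[OF int kM])
    show "AE x in PiM I (\<lambda>_. gauss1). norm (k x) \<le> norm (exp (\<bar>k (\<lambda>_. 0)\<bar> + L * (\<Sum>i\<in>I. \<bar>x i\<bar>)))"
    proof (rule AE_I2)
      fix x :: "'i \<Rightarrow> real"
      show "norm (k x) \<le> norm (exp (\<bar>k (\<lambda>_. 0)\<bar> + L * (\<Sum>i\<in>I. \<bar>x i\<bar>)))"
        using le[of x] exp_ge_add_one_self[of "\<bar>k (\<lambda>_. 0)\<bar> + L * (\<Sum>i\<in>I. \<bar>x i\<bar>)"]
        unfolding real_norm_def abs_exp_cancel by linarith
    qed
  qed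
qed

lemma integrable_gauss1_lipschitz:
  fixes k :: "real \<Rightarrow> real"
  assumes kL: "\<And>x y. \<bar>k x - k y\<bar> \<le> L * \<bar>x - y\<bar>"
  shows "integrable gauss1 (\<lambda>x. exp (k x))" and "integrable gauss1 k"
proof -
  have [measurable]: "k \<in> borel_measurable borel"
    by (intro borel_measurable_continuous_onI real_lipschitz_continuous_on; fact)
  have int: "integrable gauss1 (\<lambda>x. exp (\<bar>k 0\<bar> + L * \<bar>x\<bar>))"
    using integrable_normal_exp_abs[of "\<bar>k 0\<bar>" L] by (simp add: integrable_density)
  have le: "\<bar>k x\<bar> \<le> \<bar>k 0\<bar> + L * \<bar>x\<bar>" for x
    using kL[of x 0] by simp
  show "integrable gauss1 (\<lambda>x. exp (k x))"
    by (rule Bochner_Integration.integrable_bound[OF int]) (auto intro!: AE_I2 order_trans[OF _ le])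
  show "integrable gauss1 k"
  proof (rule Bochner_Integration.integrable_bound[OF int])
    show "AE x in gauss1. norm (k x) \<le> norm (exp (\<bar>k 0\<bar> + L * \<bar>x\<bar>))"
    proof (rule AE_I2)
      fix x
      show "norm (k x) \<le> norm (exp (\<bar>k 0\<bar> + L * \<bar>x\<bar>))"
        using le[of x] exp_ge_add_one_self[of "\<bar>k 0\<bar> + L * \<bar>x\<bar>"]
        unfolding real_norm_def abs_exp_cancel by linarith
    qed
  qed simp
qed

text \<open>Induction on the set of coordinates. Squared distance and \<open>l1\<close> distance
  both split into the part of the new coordinate and the part of the old ones, so the
  one-dimensional inequality can be applied to sections and the induction hypothesis to what is
  left.\<close>

lemma gaussian_infconv_PiM:
  fixes h f :: "('i \<Rightarrow> real) \<Rightarrow> real"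
  assumes "finite I"
    and "h \<in> borel_measurable (PiM I (\<lambda>_. gauss1))" and "f \<in> borel_measurable (PiM I (\<lambda>_. gauss1))"
    and "\<And>x y. \<bar>h x - h y\<bar> \<le> L * (\<Sum>i\<in>I. \<bar>x i - y i\<bar>)"
    and "\<And>x y. \<bar>f x - f y\<bar> \<le> L * (\<Sum>i\<in>I. \<bar>x i - y i\<bar>)"
    and "\<And>x y. h x - f y \<le> (\<Sum>i\<in>I. (x i - y i)\<^sup>2) / 2"
  shows "(\<integral>x. exp (h x) \<partial>PiM I (\<lambda>_. gauss1)) \<le> exp (\<integral>x. f x \<partial>PiM I (\<lambda>_. gauss1))"
  using assms
proof (induction I arbitrary: h f rule: finite_induct)
  case empty
  \<comment> \<open>With no coordinates the product measure is a point mass, and the hypothesis at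
    equal arguments gives \<open>h \<le> f\<close> at that point.\<close>
  have "integral\<^sup>L (PiM {} (\<lambda>_. gauss1)) k = k (\<lambda>_. undefined)" for k :: "('i \<Rightarrow> real) \<Rightarrow> real"
    by (simp add: PiM_empty lebesgue_integral_count_space_finite)
  then show ?case using empty.prems(5)[of "\<lambda>_. undefined" "\<lambda>_. undefined"] by simp
next
  case (insert j I)
  note hM = insert.prems(1) and fM = insert.prems(2) and hL = insert.prems(3) and fL = insert.prems(4)
    and hf = insert.prems(5)
  have split1: "(\<Sum>i\<in>insert j I. \<bar>(x(j := a)) i - (y(j := b)) i\<bar>) = \<bar>a - b\<bar> + (\<Sum>i\<in>I. \<bar>x i - y i\<bar>)" for x y :: "'i \<Rightarrow> real" and a b
  proof -
    have "(\<Sum>i\<in>I. \<bar>(x(j := a)) i - (y(j := b)) i\<bar>) = (\<Sum>i\<in>I. \<bar>x i - y i\<bar>)"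
      using insert.hyps by (intro sum.cong) auto
    then show ?thesis using insert.hyps by simp
  qed
  have split2: "(\<Sum>i\<in>insert j I. ((x(j := a)) i - (y(j := b)) i)\<^sup>2) = (a - b)\<^sup>2 + (\<Sum>i\<in>I. (x i - y i)\<^sup>2)" for x y :: "'i \<Rightarrow> real" and a b
  proof -
    have "(\<Sum>i\<in>I. ((x(j := a)) i - (y(j := b)) i)\<^sup>2) = (\<Sum>i\<in>I. (x i - y i)\<^sup>2)"
      using insert.hyps by (intro sum.cong) auto
    then show ?thesis using insert.hyps by simp
  qed
  have hL2: "\<bar>h (x(j := a)) - h (y(j := b))\<bar> \<le> L * \<bar>a - b\<bar> + L * (\<Sum>i\<in>I. \<bar>x i - y i\<bar>)" for x y a b
    using hL[of "x(j := a)" "y(j := b)"] unfolding split1 distrib_left .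
  have fL2: "\<bar>f (x(j := a)) - f (y(j := b))\<bar> \<le> L * \<bar>a - b\<bar> + L * (\<Sum>i\<in>I. \<bar>x i - y i\<bar>)" for x y a b
    using fL[of "x(j := a)" "y(j := b)"] unfolding split1 distrib_left .
  have hf2: "h (x(j := a)) - f (y(j := b)) \<le> (a - b)\<^sup>2 / 2 + (\<Sum>i\<in>I. (x i - y i)\<^sup>2) / 2" for x y a b
    using hf[of "x(j := a)" "y(j := b)"] unfolding split2 add_divide_distrib .
  have hL1: "\<bar>h (x(j := a)) - h (x(j := b))\<bar> \<le> L * \<bar>a - b\<bar>" for x a b
    using hL2[of x a x b] by simp
  have fL1: "\<bar>f (x(j := a)) - f (x(j := b))\<bar> \<le> L * \<bar>a - b\<bar>" for x a b
    using fL2[of x a x b] by simp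
  have int_eh: "integrable gauss1 (\<lambda>a. exp (h (x(j := a))))" for x
    by (rule integrable_gauss1_lipschitz[where L = L], rule hL1)
  have int_f: "integrable gauss1 (\<lambda>a. f (x(j := a)))" for x
    by (rule integrable_gauss1_lipschitz[where L = L], rule fL1)
  \<comment> \<open>The logarithmic partial integral of \<open>exp h\<close> and the partial integral of \<open>f\<close> inherit all hypotheses.\<close>
  define H where "H x = ln (\<integral>a. exp (h (x(j := a))) \<partial>gauss1)" for x
  define F where "F x = (\<integral>a. f (x(j := a)) \<partial>gauss1)" for x
  have eH: "exp (H x) = (\<integral>a. exp (h (x(j := a))) \<partial>gauss1)" for x
    unfolding H_def by (rule exp_ln) (rule gauss1.integral_exp_pos[OF int_eh])
  have hM2[measurable]: "(\<lambda>(x, a). h (x(j := a))) \<in> borel_measurable (PiM I (\<lambda>_. gauss1) \<Otimes>\<^sub>M gauss1)"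
    using measurable_compose[OF measurable_add_dim hM] unfolding split_def .
  have fM2[measurable]: "(\<lambda>(x, a). f (x(j := a))) \<in> borel_measurable (PiM I (\<lambda>_. gauss1) \<Otimes>\<^sub>M gauss1)"
    using measurable_compose[OF measurable_add_dim fM] unfolding split_def .
  have FM: "F \<in> borel_measurable (PiM I (\<lambda>_. gauss1))"
    unfolding F_def[abs_def] by (rule gauss1.borel_measurable_lebesgue_integral) (rule fM2)
  have HM: "H \<in> borel_measurable (PiM I (\<lambda>_. gauss1))"
    unfolding H_def[abs_def]
    by (intro borel_measurable_ln gauss1.borel_measurable_lebesgue_integral) (use hM2 in measurable)
  have le_H: "H x \<le> H y + L * (\<Sum>i\<in>I. \<bar>x i - y i\<bar>)" for x y
  proof -
    let ?d = "L * (\<Sum>i\<in>I. \<bar>x i - y i\<bar>)"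
    have "exp (H x) \<le> (\<integral>a. exp ?d * exp (h (y(j := a))) \<partial>gauss1)"
      unfolding eH
    proof (rule integral_mono[OF int_eh])
      show "integrable gauss1 (\<lambda>a. exp ?d * exp (h (y(j := a))))"
        by (rule integrable_mult_right[OF int_eh])
      show "exp (h (x(j := a))) \<le> exp ?d * exp (h (y(j := a)))" for a
        using hL2[of x a y a] by (simp flip: exp_add)
    qed
    also have "\<dots> = exp (?d + H y)" by (simp add: eH exp_add)
    finally show ?thesis by simp
  qed
  have le_F: "F x \<le> F y + L * (\<Sum>i\<in>I. \<bar>x i - y i\<bar>)" for x y
  proof -
    let ?d = "L * (\<Sum>i\<in>I. \<bar>x i - y i\<bar>)"
    have "F x \<le> (\<integral>a. f (y(j := a)) + ?d \<partial>gauss1)"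
      unfolding F_def
    proof (rule integral_mono[OF int_f])
      show "integrable gauss1 (\<lambda>a. f (y(j := a)) + ?d)"
        using int_f by simp
      show "f (x(j := a)) \<le> f (y(j := a)) + ?d" for a
        using fL2[of x a y a] by simp
    qed
    also have "\<dots> = F y + ?d" using int_f[of y] using gauss1.prob_space by (simp add: F_def)
    finally show ?thesis .
  qed
  \<comment> \<open>For fixed \<open>x\<close> and \<open>y\<close> the quadratic cost of the old
    coordinates is a constant \<open>?c\<close>. Subtracting it from \<open>h\<close> leaves two
    sections that satisfy the one-dimensional hypothesis with cost
    \<open>(a - b)\<^sup>2 / 2\<close>.\<close>
  have HF: "H x - F y \<le> (\<Sum>i\<in>I. (x i - y i)\<^sup>2) / 2" for x y
  proof -
    let ?c = "(\<Sum>i\<in>I. (x i - y i)\<^sup>2) / 2"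
    have "(\<integral>a. exp (h (x(j := a)) - ?c) \<partial>gauss1) \<le> exp (F y)"
      unfolding F_def
    proof (rule gaussian_infconv_gauss1[where L = L])
      show "\<bar>(h (x(j := a)) - ?c) - (h (x(j := b)) - ?c)\<bar> \<le> L * \<bar>a - b\<bar>" for a b
        using hL1[of x a b] by simp
      show "\<bar>f (y(j := a)) - f (y(j := b))\<bar> \<le> L * \<bar>a - b\<bar>" for a b by (rule fL1)
      show "(h (x(j := a)) - ?c) - f (y(j := b)) \<le> (a - b)\<^sup>2 / 2" for a b
        using hf2[of x a y b] by simp
    qed
    also have "(\<integral>a. exp (h (x(j := a)) - ?c) \<partial>gauss1) = exp (H x - ?c)"
      by (simp add: exp_diff eH)
    finally show ?thesis by simp
  qed
  have sym: "(\<Sum>i\<in>I. \<bar>x i - y i\<bar>) = (\<Sum>i\<in>I. \<bar>y i - x i\<bar>)" for x y :: "'i \<Rightarrow> real"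
    by (simp add: abs_minus_commute)
  have IH: "(\<integral>x. exp (H x) \<partial>PiM I (\<lambda>_. gauss1)) \<le> exp (\<integral>x. F x \<partial>PiM I (\<lambda>_. gauss1))"
  proof (rule insert.IH[OF HM FM])
    show "\<bar>H x - H y\<bar> \<le> L * (\<Sum>i\<in>I. \<bar>x i - y i\<bar>)" for x y
      using le_H[of x y] le_H[of y x] sym[of x y] by (simp add: abs_le_iff)
    show "\<bar>F x - F y\<bar> \<le> L * (\<Sum>i\<in>I. \<bar>x i - y i\<bar>)" for x y
      using le_F[of x y] le_F[of y x] sym[of x y] by (simp add: abs_le_iff)
  qed (rule HF)
  have fin: "finite (insert j I)" using insert.hyps by simp
  have "(\<integral>x. exp (h x) \<partial>PiM (insert j I) (\<lambda>_. gauss1)) = (\<integral>x. exp (H x) \<partial>PiM I (\<lambda>_. gauss1))"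
    unfolding eH by (rule gaussP.product_integral_insert[OF insert.hyps(1,2) integrable_PiM_gauss1_lipschitz(1)[OF fin hM hL]])
  moreover have "(\<integral>x. f x \<partial>PiM (insert j I) (\<lambda>_. gauss1)) = (\<integral>x. F x \<partial>PiM I (\<lambda>_. gauss1))"
    unfolding F_def by (rule gaussP.product_integral_insert[OF insert.hyps(1,2) integrable_PiM_gauss1_lipschitz(2)[OF fin fM fL]])
  ultimately show ?case using IH by simp
qed

section \<open>Isotropic Gaussian vectors: product structure, scaling, convolution\<close>

text \<open>\<open>nn_integral_lborel_prod\<close> runs over basis vectors; \<open>axis\<close>
  matches these with the coordinates.\<close>

lemma nn_integral_lborel_prod_vec:
  fixes f :: "'p::finite \<Rightarrow> real \<Rightarrow> ennreal"
  assumes [measurable]: "\<And>i. f i \<in> borel_measurable borel"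
  shows "(\<integral>\<^sup>+x. (\<Prod>i\<in>UNIV. f i (x $ i)) \<partial>(lborel :: (real ^ 'p) measure)) = (\<Prod>i\<in>UNIV. \<integral>\<^sup>+t. f i t \<partial>lborel)"
proof -
  define e where "e = (\<lambda>i::'p. axis i (1::real))"
  have inj: "inj e" by (auto simp: inj_def e_def axis_eq_axis)
  have B: "(Basis :: (real ^ 'p) set) = range e" by (auto simp: Basis_vec_def e_def)
  define g where "g = (\<lambda>b. f (inv e b))"
  have g: "g (e i) = f i" for i using inj by (simp add: g_def)
  have "(\<integral>\<^sup>+x. (\<Prod>b\<in>Basis. g b (x \<bullet> b)) \<partial>(lborel :: (real ^ 'p) measure)) = (\<Prod>b\<in>Basis. \<integral>\<^sup>+t. g b t \<partial>lborel)"
    by (rule nn_integral_lborel_prod) (auto simp: g_def)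
  moreover have "x \<bullet> e i = x $ i" for x i by (simp add: e_def inner_axis)
  ultimately show ?thesis
    unfolding B prod.reindex[OF inj] o_def g by simp
qed

lemma borel_measurable_iso_normal_density[measurable]:
  "iso_normal_density \<sigma> \<in> borel_measurable borel"
  unfolding iso_normal_density_def[abs_def]
  by (intro borel_measurable_prod measurable_compose[OF _ borel_measurable_normal_density]
        borel_measurable_continuous_onI continuous_intros)

lemma iso_normal_density_nonneg: "iso_normal_density \<sigma> x \<ge> 0"
  by (simp add: iso_normal_density_def prod_nonneg)

text \<open>The free scale is needed because the noise vectors and their sums over a window have
  different variances; \<open>std_gaussian\<close> is the case of scale 1.\<close>

definition iso_gaussian :: "real \<Rightarrow> (real ^ 'p) measure" where
  "iso_gaussian \<sigma> = density lborel (\<lambda>x. ennreal (iso_normal_density \<sigma> x))"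

lemma sets_iso_gaussian[simp, measurable_cong]: "sets (iso_gaussian \<sigma>) = sets borel"
  by (simp add: iso_gaussian_def)

lemma space_iso_gaussian[simp]: "space (iso_gaussian \<sigma>) = UNIV"
  by (simp add: iso_gaussian_def)

lemma std_gaussian_eq: "std_gaussian = iso_gaussian 1"
  by (simp add: std_gaussian_def iso_gaussian_def)

lemma sets_std_gaussian[simp, measurable_cong]: "sets std_gaussian = sets borel"
  by (simp add: std_gaussian_eq)

lemma space_std_gaussian[simp]: "space std_gaussian = UNIV"
  by (simp add: std_gaussian_eq)

lemma measurable_vec_nth_PiM: "vec_nth \<in> measurable borel (PiM UNIV (\<lambda>_::'p::finite. borel :: real measure))"
proof -
  have "(\<lambda>x i. x $ i) \<in> measurable borel (PiM UNIV (\<lambda>_::'p. borel :: real measure))"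
  proof (rule measurable_PiM_single')
    show "(\<lambda>x :: real ^ 'p. x $ i) \<in> borel_measurable borel" for i
      by (intro borel_measurable_continuous_onI continuous_intros)
  qed auto
  then show ?thesis .
qed

lemma measurable_vec_lambda_PiM:
  "vec_lambda \<in> borel_measurable (PiM UNIV (\<lambda>_::'p::finite. borel :: real measure))"
proof (rule borel_measurable_euclidean_space[THEN iffD2], rule ballI)
  fix b :: "real ^ 'p" assume "b \<in> Basis"
  then obtain i where "b = axis i 1" by (auto simp: Basis_vec_def)
  moreover have "(\<lambda>x. x i) \<in> borel_measurable (PiM UNIV (\<lambda>_::'p. borel :: real measure))" for i
    by (rule measurable_component_singleton) simp
  ultimately show "(\<lambda>x. vec_lambda x \<bullet> b) \<in> borel_measurable (PiM UNIV (\<lambda>_::'p. borel :: real measure))"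
    by (simp add: inner_axis)
qed

text \<open>It suffices to compare the measures on boxes, where both density and indicator factor
  over the coordinates. This carries integrals, and with them the inequality on the product space,
  over to \<open>real ^ 'p\<close>.\<close>

lemma distr_std_gaussian_PiM:
  "distr std_gaussian (PiM UNIV (\<lambda>_::'p::finite. gauss1)) vec_nth = PiM UNIV (\<lambda>_. gauss1)"
proof (rule gaussP.PiM_eqI)
  have m: "vec_nth \<in> measurable (std_gaussian :: (real ^ 'p) measure) (PiM UNIV (\<lambda>_. gauss1))"
    using measurable_vec_nth_PiM by (simp cong: measurable_cong_sets sets_PiM_cong)
  fix A :: "'p \<Rightarrow> real set" assume A: "\<And>i. i \<in> UNIV \<Longrightarrow> A i \<in> sets gauss1"
  then have [measurable]: "A i \<in> sets borel" for i by simp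
  have "Pi\<^sub>E UNIV A \<in> sets (PiM UNIV (\<lambda>_::'p. gauss1))"
    using A by (intro sets_PiM_I_finite) auto
  then have "emeasure (distr std_gaussian (PiM UNIV (\<lambda>_. gauss1)) vec_nth) (Pi\<^sub>E UNIV A)
    = emeasure std_gaussian (vec_nth -` Pi\<^sub>E UNIV A)"
    using m by (subst emeasure_distr) auto
  also have "vec_nth -` Pi\<^sub>E UNIV A = {x :: real ^ 'p. \<forall>i. x $ i \<in> A i}" by auto
  also have "emeasure std_gaussian \<dots> = (\<integral>\<^sup>+x. ennreal (iso_normal_density 1 x) * indicator {x :: real ^ 'p. \<forall>i. x $ i \<in> A i} x \<partial>lborel)"
  proof -
    have "{x :: real ^ 'p. \<forall>i. x $ i \<in> A i} = (\<Inter>i. (\<lambda>x. x $ i) -` A i \<inter> space borel)" by auto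
    also have "\<dots> \<in> sets borel"
      by (intro sets.finite_INT measurable_sets[of _ borel borel] borel_measurable_continuous_onI)
         (auto intro!: continuous_intros)
    finally show ?thesis unfolding std_gaussian_def by (subst emeasure_density) auto
  qed
  also have "\<dots> = (\<integral>\<^sup>+x. (\<Prod>i\<in>UNIV. ennreal (std_normal_density (x $ i)) * indicator (A i) (x $ i)) \<partial>(lborel :: (real ^ 'p) measure))"
  proof (rule nn_integral_cong)
    fix x :: "real ^ 'p"
    have "indicator {x :: real ^ 'p. \<forall>i. x $ i \<in> A i} x = (\<Prod>i\<in>UNIV. indicator (A i) (x $ i) :: ennreal)"
    proof (cases "\<forall>i. x $ i \<in> A i")
      case False
      then obtain i where "x $ i \<notin> A i" by blast
      then have "(\<Prod>i\<in>UNIV. indicator (A i) (x $ i) :: ennreal) = 0"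
        by (intro prod_zero) (auto intro!: exI[of _ i])
      with False show ?thesis by simp
    qed simp
    moreover have "ennreal (iso_normal_density 1 x) = (\<Prod>i\<in>UNIV. ennreal (std_normal_density (x $ i)))"
      unfolding iso_normal_density_def by (subst prod_ennreal) auto
    ultimately show "ennreal (iso_normal_density 1 x) * indicator {x :: real ^ 'p. \<forall>i. x $ i \<in> A i} x
        = (\<Prod>i\<in>UNIV. ennreal (std_normal_density (x $ i)) * indicator (A i) (x $ i))"
      by (simp add: prod.distrib)
  qed
  also have "\<dots> = (\<Prod>i\<in>UNIV. \<integral>\<^sup>+t. ennreal (std_normal_density t) * indicator (A i) t \<partial>lborel)"
    by (rule nn_integral_lborel_prod_vec) auto
  also have "\<dots> = (\<Prod>i\<in>UNIV. emeasure gauss1 (A i))"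
    by (simp add: emeasure_density)
  finally show "emeasure (distr std_gaussian (PiM UNIV (\<lambda>_. gauss1)) vec_nth) (Pi\<^sub>E UNIV A) = (\<Prod>i\<in>UNIV. emeasure gauss1 (A i))" .
qed auto

lemma measurable_vec_nth_gaussian:
  "vec_nth \<in> measurable (std_gaussian :: (real ^ 'p) measure) (PiM UNIV (\<lambda>_::'p::finite. gauss1))"
  using measurable_vec_nth_PiM by (simp cong: measurable_cong_sets sets_PiM_cong)

lemma measurable_vec_lambda_gaussian:
  "vec_lambda \<in> borel_measurable (PiM UNIV (\<lambda>_::'p::finite. gauss1))"
  using measurable_vec_lambda_PiM by (simp cong: measurable_cong_sets sets_PiM_cong)

lemma prob_space_std_gaussian: "prob_space (std_gaussian :: (real ^ 'p::finite) measure)"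
proof (rule prob_space_distrD[OF measurable_vec_nth_gaussian])
  show "prob_space (distr (std_gaussian :: (real ^ 'p::finite) measure) (PiM UNIV (\<lambda>_. gauss1)) vec_nth)"
    unfolding distr_std_gaussian_PiM by (rule prob_space_PiM) (rule prob_space_gauss1)
qed

lemma integral_std_gaussian:
  fixes g :: "real ^ 'p::finite \<Rightarrow> real"
  assumes [measurable]: "g \<in> borel_measurable borel"
  shows "(\<integral>x. g x \<partial>std_gaussian) = (\<integral>y. g (vec_lambda y) \<partial>PiM UNIV (\<lambda>_. gauss1))"
    and "integrable std_gaussian g \<longleftrightarrow> integrable (PiM UNIV (\<lambda>_. gauss1)) (\<lambda>y. g (vec_lambda y))"
proof -
  have m: "(\<lambda>y. g (vec_lambda y)) \<in> borel_measurable (PiM UNIV (\<lambda>_. gauss1))"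
    by (rule measurable_compose[OF measurable_vec_lambda_gaussian]) simp
  show "(\<integral>x. g x \<partial>std_gaussian) = (\<integral>y. g (vec_lambda y) \<partial>PiM UNIV (\<lambda>_. gauss1))"
    using integral_distr[OF measurable_vec_nth_gaussian m] unfolding distr_std_gaussian_PiM by simp
  show "integrable std_gaussian g \<longleftrightarrow> integrable (PiM UNIV (\<lambda>_. gauss1)) (\<lambda>y. g (vec_lambda y))"
    using integrable_distr_eq[OF measurable_vec_nth_gaussian m] unfolding distr_std_gaussian_PiM by simp
qed

lemma borel_measurable_lipschitz:
  fixes d :: "'a::metric_space \<Rightarrow> 'b::metric_space"
  assumes "L-lipschitz_on UNIV d"
  shows "d \<in> borel_measurable borel"
  by (rule borel_measurable_continuous_onI[OF lipschitz_on_continuous_on[OF assms]])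

text \<open>
  The bound is the transport inequality for \<open>h = \<kappa> d - \<kappa>\<^sup>2 / 2\<close> and \<open>f = \<kappa> d\<close>.
\<close>

lemma gaussian_mgf_lipschitz:
  fixes d :: "real ^ 'p::finite \<Rightarrow> real"
  assumes lip: "1-lipschitz_on UNIV d" and \<kappa>: "\<kappa> \<ge> 0"
  shows "integrable std_gaussian (\<lambda>x. exp (\<kappa> * d x))"
    and "integrable std_gaussian d"
    and "(\<integral>x. exp (\<kappa> * d x) \<partial>std_gaussian) \<le> exp (\<kappa> * (\<integral>x. d x \<partial>std_gaussian) + \<kappa>\<^sup>2 / 2)"
proof -
  have [measurable]: "d \<in> borel_measurable borel" by (rule borel_measurable_lipschitz[OF lip])
  have dn: "\<bar>d x - d y\<bar> \<le> norm (x - y)" for x y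
    using lipschitz_onD[OF lip, of x y] by (simp add: dist_real_def dist_norm)
  have dl1: "\<bar>d (vec_lambda x) - d (vec_lambda y)\<bar> \<le> (\<Sum>i\<in>UNIV. \<bar>x i - y i\<bar>)" for x y
    using order_trans[OF dn norm_le_l1_cart, of "vec_lambda x" "vec_lambda y"] by simp
  have m: "(\<lambda>y. d (vec_lambda y)) \<in> borel_measurable (PiM UNIV (\<lambda>_. gauss1))"
    by (rule measurable_compose[OF measurable_vec_lambda_gaussian]) simp
  have klip: "\<bar>\<kappa> * d (vec_lambda x) - \<kappa> * d (vec_lambda y)\<bar> \<le> \<kappa> * (\<Sum>i\<in>UNIV. \<bar>x i - y i\<bar>)" for x y
    using mult_left_mono[OF dl1 \<kappa>, of x y] \<kappa> by (simp add: abs_mult flip: right_diff_distrib)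
  show "integrable std_gaussian (\<lambda>x. exp (\<kappa> * d x))"
    by (subst integral_std_gaussian(2), simp,
        rule integrable_PiM_gauss1_lipschitz[where L = \<kappa>]) (use m klip in auto)
  show "integrable std_gaussian d"
    by (subst integral_std_gaussian(2), simp,
        rule integrable_PiM_gauss1_lipschitz[where L = 1]) (use m dl1 in auto)
  have "(\<integral>x. exp (\<kappa> * d (vec_lambda x) - \<kappa>\<^sup>2 / 2) \<partial>PiM UNIV (\<lambda>_. gauss1))
    \<le> exp (\<integral>x. \<kappa> * d (vec_lambda x) \<partial>PiM UNIV (\<lambda>_. gauss1))"
  proof (rule gaussian_infconv_PiM[where L = \<kappa>])
    show "\<kappa> * d (vec_lambda x) - \<kappa>\<^sup>2 / 2 - \<kappa> * d (vec_lambda y) \<le> (\<Sum>i\<in>UNIV. (x i - y i)\<^sup>2) / 2" for x y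
    proof -
      define v where "v = vec_lambda x - vec_lambda y"
      have "\<kappa> * (d (vec_lambda x) - d (vec_lambda y)) \<le> \<kappa> * norm v"
        using dn[of "vec_lambda x" "vec_lambda y"] \<kappa> unfolding v_def by (intro mult_left_mono) auto
      moreover have "0 \<le> (norm v - \<kappa>)\<^sup>2" by simp
      moreover have "(norm v)\<^sup>2 = (\<Sum>i\<in>UNIV. (x i - y i)\<^sup>2)"
        unfolding power2_norm_eq_inner v_def by (simp add: inner_vec_def power2_eq_square)
      ultimately show ?thesis
        unfolding power2_diff by (simp add: algebra_simps)
    qed
  qed (use m klip in auto)
  then have "(\<integral>x. exp (\<kappa> * d x - \<kappa>\<^sup>2 / 2) \<partial>std_gaussian) \<le> exp (\<kappa> * (\<integral>x. d x \<partial>std_gaussian))"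
    by (simp add: integral_std_gaussian(1)[where g = d]
        integral_std_gaussian(1)[where g = "\<lambda>x. exp (\<kappa> * d x - \<kappa>\<^sup>2 / 2)"])
  then have "(\<integral>x. exp (\<kappa> * d x) \<partial>std_gaussian) / exp (\<kappa>\<^sup>2 / 2) \<le> exp (\<kappa> * (\<integral>x. d x \<partial>std_gaussian))"
    unfolding exp_diff by simp
  then show "(\<integral>x. exp (\<kappa> * d x) \<partial>std_gaussian) \<le> exp (\<kappa> * (\<integral>x. d x \<partial>std_gaussian) + \<kappa>\<^sup>2 / 2)"
    unfolding exp_add by (subst (asm) pos_divide_le_eq) simp_all
qed

lemma iso_gaussian_scale:
  assumes s: "s > 0"
  shows "iso_gaussian s = distr std_gaussian borel (\<lambda>x :: real ^ 'p::finite. s *\<^sub>R x)"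
proof (rule measure_eqI)
  fix A :: "(real ^ 'p) set" assume "A \<in> sets (iso_gaussian s)"
  then have [measurable]: "A \<in> sets borel" by simp
  \<comment> \<open>The Jacobian \<open>s ^ CARD('p)\<close> of the dilation is distributed as one
    factor \<open>s\<close> to each one-dimensional density.\<close>
  have dens: "ennreal (s ^ CARD('p)) * ennreal (iso_normal_density s (s *\<^sub>R x)) = ennreal (iso_normal_density 1 x)" for x :: "real ^ 'p"
  proof -
    have "s * normal_density 0 s (s * t) = std_normal_density t" for t
    proof -
      have "sqrt (2 * pi * s\<^sup>2) = sqrt (2 * pi) * s" using s by (simp add: real_sqrt_mult)
      moreover have "(s * t)\<^sup>2 / (2 * s\<^sup>2) = t\<^sup>2 / 2" using s by (simp add: power_mult_distrib)
      ultimately show ?thesis using s by (simp add: normal_density_def)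
    qed
    then have "(\<Prod>i\<in>(UNIV :: 'p set). s * normal_density 0 s (s * x $ i)) = iso_normal_density 1 x"
      by (simp add: iso_normal_density_def)
    then have "s ^ CARD('p) * iso_normal_density s (s *\<^sub>R x) = iso_normal_density 1 x"
      by (simp add: prod.distrib iso_normal_density_def)
    then show ?thesis using s by (simp flip: ennreal_mult' add: iso_normal_density_nonneg)
  qed
  have "emeasure (iso_gaussian s) A = (\<integral>\<^sup>+x. ennreal (iso_normal_density s x) * indicator A x \<partial>lborel)"
    unfolding iso_gaussian_def by (subst emeasure_density) auto
  also have "\<dots> = (\<integral>\<^sup>+x. ennreal (s ^ CARD('p)) * (ennreal (iso_normal_density s (s *\<^sub>R x)) * indicator A (s *\<^sub>R x)) \<partial>lborel)"
    using s by (subst lborel_affine[of s 0])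
      (simp_all add: nn_integral_density nn_integral_distr ennreal_power)
  also have "\<dots> = (\<integral>\<^sup>+x. ennreal (iso_normal_density 1 x) * indicator ((\<lambda>x. s *\<^sub>R x) -` A) x \<partial>lborel)"
    by (simp add: dens mult.assoc[symmetric] indicator_def)
  also have "\<dots> = emeasure std_gaussian ((\<lambda>x. s *\<^sub>R x) -` A)"
  proof -
    have "(\<lambda>x. s *\<^sub>R x) -` A \<inter> space borel \<in> sets borel" by measurable
    then show ?thesis unfolding std_gaussian_def by (subst emeasure_density) auto
  qed
  also have "\<dots> = emeasure (distr std_gaussian borel (\<lambda>x :: real ^ 'p. s *\<^sub>R x)) A"
    by (subst emeasure_distr) auto
  finally show "emeasure (iso_gaussian s) A = emeasure (distr std_gaussian borel (\<lambda>x. s *\<^sub>R x)) A" .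
qed simp

lemma prob_space_iso_gaussian: "s > 0 \<Longrightarrow> prob_space (iso_gaussian s :: (real ^ 'p::finite) measure)"
  by (subst iso_gaussian_scale) (auto intro: prob_space.prob_space_distr[OF prob_space_std_gaussian])

text \<open>Fubini, the translation \<open>z = x + y\<close> for fixed \<open>y\<close>, and Fubini
  again exhibit the density of the sum as a convolution. That convolution factors over the
  coordinates into convolutions of one-dimensional centred normal densities.\<close>

lemma iso_gaussian_convolution:
  assumes ab: "a > 0" "b > 0"
  shows "distr (iso_gaussian a \<Otimes>\<^sub>M iso_gaussian b) borel (\<lambda>(x, y). x + y :: real ^ 'p::finite) = iso_gaussian (sqrt (a\<^sup>2 + b\<^sup>2))"
proof (rule measure_eqI)
  let ?g = "\<lambda>s x. ennreal (iso_normal_density s (x :: real ^ 'p))"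
  interpret Gb: prob_space "iso_gaussian b :: (real ^ 'p) measure" by (rule prob_space_iso_gaussian) fact
  fix A assume "A \<in> sets (distr (iso_gaussian a \<Otimes>\<^sub>M iso_gaussian b) borel (\<lambda>(x, y). x + y :: real ^ 'p))"
  then have [measurable]: "A \<in> sets borel" by simp
  have "emeasure (distr (iso_gaussian a \<Otimes>\<^sub>M iso_gaussian b) borel (\<lambda>(x, y). x + y)) A
    = (\<integral>\<^sup>+z. indicator A z \<partial>distr (iso_gaussian a \<Otimes>\<^sub>M iso_gaussian b) borel (\<lambda>(x, y). x + y))"
    by simp
  also have "\<dots> = (\<integral>\<^sup>+x. \<integral>\<^sup>+y. indicator A (x + y) \<partial>iso_gaussian b \<partial>iso_gaussian a)"
    by (subst nn_integral_distr) (auto simp: split_def Gb.nn_integral_fst[symmetric])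
  also have "\<dots> = (\<integral>\<^sup>+x. ?g a x * (\<integral>\<^sup>+y. ?g b y * indicator A (x + y) \<partial>lborel) \<partial>lborel)"
    unfolding iso_gaussian_def by (simp add: nn_integral_density)
  also have "\<dots> = (\<integral>\<^sup>+x. \<integral>\<^sup>+y. ?g b y * (?g a x * indicator A (x + y)) \<partial>lborel \<partial>lborel)"
    by (simp add: nn_integral_cmult[symmetric] mult_ac)
  also have "\<dots> = (\<integral>\<^sup>+y. \<integral>\<^sup>+x. ?g b y * (?g a x * indicator A (x + y)) \<partial>lborel \<partial>lborel)"
    by (intro lborel_pair.Fubini') simp
  also have "\<dots> = (\<integral>\<^sup>+y. \<integral>\<^sup>+z. ?g b y * (?g a (z - y) * indicator A z) \<partial>lborel \<partial>lborel)"
  proof (rule nn_integral_cong)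
    fix y :: "real ^ 'p"
    have "(\<integral>\<^sup>+z. ?g b y * (?g a (z - y) * indicator A z) \<partial>lborel)
      = (\<integral>\<^sup>+z. ?g b y * (?g a (z - y) * indicator A z) \<partial>distr lborel borel ((+) y))"
      by (simp add: lborel_distr_plus)
    also have "\<dots> = (\<integral>\<^sup>+x. ?g b y * (?g a x * indicator A (x + y)) \<partial>lborel)"
      by (subst nn_integral_distr) (auto simp: add.commute)
    finally show "(\<integral>\<^sup>+x. ?g b y * (?g a x * indicator A (x + y)) \<partial>lborel)
      = (\<integral>\<^sup>+z. ?g b y * (?g a (z - y) * indicator A z) \<partial>lborel)" by simp
  qed
  also have "\<dots> = (\<integral>\<^sup>+z. \<integral>\<^sup>+y. ?g b y * (?g a (z - y) * indicator A z) \<partial>lborel \<partial>lborel)"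
    by (intro lborel_pair.Fubini') simp
  also have "\<dots> = (\<integral>\<^sup>+z. (\<integral>\<^sup>+y. ?g a (z - y) * ?g b y \<partial>lborel) * indicator A z \<partial>lborel)"
    by (intro nn_integral_cong, subst nn_integral_multc[symmetric]) (auto simp: mult_ac)
  also have "\<dots> = (\<integral>\<^sup>+z. ?g (sqrt (a\<^sup>2 + b\<^sup>2)) z * indicator A z \<partial>lborel)"
  proof -
    have "(\<integral>\<^sup>+y. ?g a (z - y) * ?g b y \<partial>lborel) = ?g (sqrt (a\<^sup>2 + b\<^sup>2)) z" for z :: "real ^ 'p"
    proof -
      have "?g a (z - y) * ?g b y = (\<Prod>i\<in>UNIV. ennreal (normal_density 0 a (z $ i - y $ i) * normal_density 0 b (y $ i)))" for y
        by (simp add: iso_normal_density_def prod_ennreal ennreal_mult prod.distrib prod_nonneg)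
      then have "(\<integral>\<^sup>+y. ?g a (z - y) * ?g b y \<partial>lborel)
        = (\<integral>\<^sup>+y. (\<Prod>i\<in>UNIV. ennreal (normal_density 0 a (z $ i - y $ i) * normal_density 0 b (y $ i))) \<partial>(lborel :: (real ^ 'p) measure))"
        by simp
      also have "\<dots> = (\<Prod>i\<in>UNIV. \<integral>\<^sup>+t. ennreal (normal_density 0 a (z $ i - t) * normal_density 0 b t) \<partial>lborel)"
        by (rule nn_integral_lborel_prod_vec) simp
      also have "\<dots> = (\<Prod>i\<in>UNIV. ennreal (normal_density 0 (sqrt (a\<^sup>2 + b\<^sup>2)) (z $ i)))"
        using fun_cong[OF conv_normal_density_zero_mean[OF ab]] by simp
      also have "\<dots> = ?g (sqrt (a\<^sup>2 + b\<^sup>2)) z"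
        by (simp add: iso_normal_density_def prod_ennreal)
      finally show ?thesis .
    qed
    then show ?thesis by simp
  qed
  also have "\<dots> = emeasure (iso_gaussian (sqrt (a\<^sup>2 + b\<^sup>2))) A"
    unfolding iso_gaussian_def by (subst emeasure_density) auto
  finally show "emeasure (distr (iso_gaussian a \<Otimes>\<^sub>M iso_gaussian b) borel (\<lambda>(x, y). x + y)) A
    = emeasure (iso_gaussian (sqrt (a\<^sup>2 + b\<^sup>2))) A" .
qed simp

subsection \<open>Gauges and their proximal maps\<close>

lemma minkowski_gauge_le:
  assumes "t > 0" "x \<in> (\<lambda>c. t *\<^sub>R c) ` C"
  shows "minkowski_gauge C x \<le> t"
  unfolding minkowski_gauge_def using assms by (intro cInf_lower) (auto intro!: bdd_belowI[of _ 0])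

locale gauge_body =
  fixes C :: "'a::euclidean_space set"
  assumes conv: "convex C" and int0: "0 \<in> interior C"
begin

abbreviation "G \<equiv> minkowski_gauge C"

text \<open>Some radius of a ball around the origin inside \<open>C\<close>, not the largest one.
  Its reciprocal serves as a Lipschitz constant of the gauge and as a bound on its
  subgradients.\<close>

definition inradius :: real where
  "inradius = (SOME \<rho>. \<rho> > 0 \<and> cball 0 \<rho> \<subseteq> C)"

lemma inradius: "inradius > 0" "cball 0 inradius \<subseteq> C"
proof -
  have "\<exists>\<rho>. \<rho> > 0 \<and> cball 0 \<rho> \<subseteq> C"
    using int0 unfolding mem_interior_cball by blast
  from someI_ex[OF this] show "inradius > 0" "cball 0 inradius \<subseteq> C"
    by (auto simp: inradius_def)
qed

lemma mem_scaled:
  assumes "t > 0" "norm x \<le> t * inradius"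
  shows "x \<in> (\<lambda>c. t *\<^sub>R c) ` C"
proof
  show "x = t *\<^sub>R (x /\<^sub>R t)" using assms by simp
  have "norm (x /\<^sub>R t) \<le> inradius"
    using assms by (simp add: field_simps)
  then show "x /\<^sub>R t \<in> C" using inradius(2) by (auto simp: subset_iff)
qed

lemma scales_nonempty: "{t. t > 0 \<and> x \<in> (\<lambda>c. t *\<^sub>R c) ` C} \<noteq> {}"
proof -
  have "norm x / inradius + 1 > 0" using inradius(1) by (auto intro: add_nonneg_pos)
  moreover have "x \<in> (\<lambda>c. (norm x / inradius + 1) *\<^sub>R c) ` C"
    using inradius(1) calculation by (intro mem_scaled) (auto simp: field_simps)
  ultimately show ?thesis by blast
qed

lemma gauge_nonneg: "G x \<ge> 0"
  unfolding minkowski_gauge_def by (rule cInf_greatest[OF scales_nonempty]) auto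

lemma gauge_le_norm: "G x \<le> norm x / inradius"
proof (rule field_le_epsilon)
  fix e :: real assume "e > 0"
  then show "G x \<le> norm x / inradius + e"
    using inradius(1)
    by (intro minkowski_gauge_le mem_scaled) (auto simp: field_simps add_nonneg_pos)
qed

lemma gauge_zero: "G 0 = 0"
  using gauge_le_norm[of 0] gauge_nonneg[of 0] by simp

text \<open>\<open>C\<close> need not be closed, so the infimum in the gauge need not be attained;
  the arguments below work with nearly optimal scales instead.\<close>

lemma gauge_approx:
  assumes "e > 0"
  obtains t c where "t > 0" "c \<in> C" "x = t *\<^sub>R c" "t < G x + e"
proof -
  let ?S = "{t. t > 0 \<and> x \<in> (\<lambda>c. t *\<^sub>R c) ` C}"
  have "?S \<noteq> {}" by (rule scales_nonempty)
  moreover have "Inf ?S < G x + e" using assms by (simp add: minkowski_gauge_def)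
  ultimately obtain t where "t \<in> ?S" "t < G x + e" by (rule cInf_lessD[THEN bexE])
  then show ?thesis using that by blast
qed

lemma gauge_add_le: "G (x + y) \<le> G x + G y"
proof (rule field_le_epsilon)
  fix e :: real assume "e > 0"
  then have e: "e / 2 > 0" by simp
  obtain t c where t: "t > 0" "c \<in> C" "x = t *\<^sub>R c" "t < G x + e / 2" by (rule gauge_approx[OF e])
  obtain s d where s: "s > 0" "d \<in> C" "y = s *\<^sub>R d" "s < G y + e / 2" by (rule gauge_approx[OF e])
  \<comment> \<open>The sum is \<open>t + s\<close> times a convex combination of \<open>c\<close>
    and \<open>d\<close>, so convexity of \<open>C\<close> makes \<open>t + s\<close> an admissible
    scale.\<close>
  have "x + y = (t + s) *\<^sub>R ((t / (t + s)) *\<^sub>R c + (s / (t + s)) *\<^sub>R d)"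
    using add_pos_pos[OF t(1) s(1)] by (simp add: t(3) s(3) scaleR_add_right)
  moreover have "(t / (t + s)) *\<^sub>R c + (s / (t + s)) *\<^sub>R d \<in> C"
    using t s by (intro convexD[OF conv]) (auto simp: add_divide_distrib[symmetric])
  ultimately have "G (x + y) \<le> t + s"
    using t(1) s(1) by (intro minkowski_gauge_le) auto
  then show "G (x + y) \<le> G x + G y + e" using t(4) s(4) by simp
qed

lemma gauge_scale_le:
  assumes "a \<ge> 0"
  shows "G (a *\<^sub>R x) \<le> a * G x"
proof (cases "a = 0")
  case True
  then show ?thesis by (simp add: gauge_zero)
next
  case False
  with assms have a: "a > 0" by simp
  show ?thesis
  proof (rule field_le_epsilon)
    fix e :: real assume "e > 0"
    then have e: "e / a > 0" using a by simp
    obtain t c where t: "t > 0" "c \<in> C" "x = t *\<^sub>R c" "t < G x + e / a" by (rule gauge_approx[OF e])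
    have "G (a *\<^sub>R x) \<le> a * t"
      using t a by (intro minkowski_gauge_le) auto
    also have "\<dots> \<le> a * (G x + e / a)" using t(4) a by (intro mult_left_mono) auto
    also have "\<dots> = a * G x + e" using a by (simp add: field_simps)
    finally show "G (a *\<^sub>R x) \<le> a * G x + e" .
  qed
qed

lemma gauge_convex:
  assumes "0 \<le> u" "u \<le> 1"
  shows "G ((1 - u) *\<^sub>R x + u *\<^sub>R y) \<le> (1 - u) * G x + u * G y"
  using gauge_add_le[of "(1 - u) *\<^sub>R x" "u *\<^sub>R y"] gauge_scale_le[of "1 - u" x] gauge_scale_le[of u y] assms
  by linarith

lemma gauge_diff_le: "G y - G x \<le> norm (y - x) / inradius"
  using gauge_add_le[of x "y - x"] gauge_le_norm[of "y - x"] by simp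

lemma continuous_on_gauge: "continuous_on S G"
proof (rule lipschitz_on_continuous_on)
  show "(1 / inradius)-lipschitz_on S G"
  proof (rule lipschitz_onI)
    fix x y
    show "dist (G x) (G y) \<le> 1 / inradius * dist x y"
      using gauge_diff_le[of x y] gauge_diff_le[of y x] by (auto simp: dist_real_def dist_norm norm_minus_commute abs_le_iff)
  qed (use inradius in auto)
qed

text \<open>Testing the subgradient inequality at \<open>x + v\<close> gives the square of
  \<open>norm v\<close> on one side and the Lipschitz bound on the other.\<close>

lemma subdifferential_gauge_bounded:
  assumes "v \<in> subdifferential G x"
  shows "norm v \<le> 1 / inradius"
proof (cases "v = 0")
  case True
  then show ?thesis using inradius(1) by simp
next
  case False
  have "G (x + v) \<ge> G x + v \<bullet> ((x + v) - x)"
    using assms unfolding subdifferential_def by blast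
  then have "norm v * norm v \<le> 1 / inradius * norm v"
    using gauge_diff_le[of "x + v" x] by (simp add: dot_square_norm power2_eq_square)
  then show ?thesis using False by (subst (asm) mult_le_cancel_right_pos) auto
qed

text \<open>Where the gauge vanishes it is minimal and 0 is a subgradient. Elsewhere a hyperplane
  separates \<open>x\<close> from the strict sublevel set of \<open>G x\<close>; its normal,
  rescaled so that its inner product with \<open>x\<close> is \<open>G x\<close>, is dominated by
  the gauge by homogeneity.\<close>

lemma subdifferential_gauge_nonempty: "subdifferential G x \<noteq> {}"
proof (cases "G x = 0")
  case True
  then have "0 \<in> subdifferential G x"
    by (auto simp: subdifferential_def gauge_nonneg)
  then show ?thesis by blast
next
  case False
  define s where "s = G x"
  have s: "s > 0" using False gauge_nonneg[of x] by (simp add: s_def)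
  let ?S = "{y. G y < s}"
  have "convex ?S"
  proof (rule convexI)
    fix y z and u v :: real assume yz: "y \<in> ?S" "z \<in> ?S" and uv: "0 \<le> u" "0 \<le> v" "u + v = 1"
    have "G (u *\<^sub>R y + v *\<^sub>R z) \<le> u * G y + v * G z"
      using gauge_add_le[of "u *\<^sub>R y" "v *\<^sub>R z"] gauge_scale_le[of u y] gauge_scale_le[of v z] uv by linarith
    also have "\<dots> < s"
      by (rule convex_bound_lt) (use yz uv in auto)
    finally show "u *\<^sub>R y + v *\<^sub>R z \<in> ?S" by simp
  qed
  moreover have "0 \<in> ?S" using s by (simp add: gauge_zero)
  moreover have "?S \<inter> {x} = {}" by (simp add: s_def)
  ultimately obtain a b where ab: "a \<noteq> 0" "\<forall>y\<in>?S. a \<bullet> y \<le> b" "\<forall>y\<in>{x}. b \<le> a \<bullet> y"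
    using separating_hyperplane_sets[of ?S "{x}"] by blast
  \<comment> \<open>\<open>y\<close> is scaled into the strict sublevel set before the separation is
    used. The positive \<open>e\<close> keeps the scale finite when \<open>G y = 0\<close> and makes
    the sublevel inequality strict.\<close>
  have key: "s * (a \<bullet> y) \<le> (a \<bullet> x) * (G y + e)" if "e > 0" for y e
  proof -
    have Ge: "G y + e > 0" using that gauge_nonneg[of y] by simp
    have "G ((s / (G y + e)) *\<^sub>R y) \<le> s / (G y + e) * G y"
      using s Ge by (intro gauge_scale_le) simp
    also have "\<dots> < s" using s Ge that by (simp add: divide_less_eq)
    finally have "a \<bullet> ((s / (G y + e)) *\<^sub>R y) \<le> a \<bullet> x" using ab by force
    then show ?thesis using Ge by (simp add: field_simps)
  qed
  have ax: "a \<bullet> x > 0"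
  proof -
    have "0 < s * (a \<bullet> a)" using s ab(1) by simp
    also have "\<dots> \<le> (a \<bullet> x) * (G a + 1)" by (rule key) simp
    finally show ?thesis
      using gauge_nonneg[of a] by (simp add: zero_less_mult_iff)
  qed
  define v where "v = (s / (a \<bullet> x)) *\<^sub>R a"
  have vx: "v \<bullet> x = s" using ax by (simp add: v_def)
  have "v \<bullet> y \<le> G y" for y
  proof (rule field_le_epsilon)
    fix e :: real assume "e > 0"
    from key[OF this, of y] show "v \<bullet> y \<le> G y + e" using ax by (simp add: v_def field_simps)
  qed
  then have "v \<in> subdifferential G x"
    using vx by (simp add: subdifferential_def inner_diff_right s_def)
  then show ?thesis by blast
qed

end

section \<open>The proximal map of the gauge\<close>

lemma denoise_is_arg_min:
  fixes C :: "(real ^ 'p) set"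
  assumes C: "gauge_body C" and lam: "lam \<ge> 0"
  shows "1 / 2 * (norm (z - denoise C lam z))\<^sup>2 + lam * minkowski_gauge C (denoise C lam z)
    \<le> 1 / 2 * (norm (z - x))\<^sup>2 + lam * minkowski_gauge C x"
proof -
  interpret gauge_body C by fact
  define F where "F x = 1 / 2 * (norm (z - x))\<^sup>2 + lam * G x" for x
  \<comment> \<open>Outside the ball of radius \<open>R\<close> around \<open>z\<close> the
    quadratic term alone exceeds \<open>F z\<close>, so a minimum over this compact ball is
    global.\<close>
  define R where "R = sqrt (2 * F z)"
  have F_ge: "F x \<ge> 1 / 2 * (norm (z - x))\<^sup>2" for x
    using lam gauge_nonneg[of x] by (simp add: F_def)
  then have Fz: "F z \<ge> 0" by (rule order_trans[rotated]) simp
  then have R: "R \<ge> 0" "R\<^sup>2 = 2 * F z" by (auto simp: R_def)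
  have "continuous_on (cball z R) F"
    unfolding F_def[abs_def] by (intro continuous_intros continuous_on_gauge)
  moreover have "cball z R \<noteq> {}" using R by simp
  ultimately obtain m where m: "m \<in> cball z R" "\<forall>y\<in>cball z R. F m \<le> F y"
    using continuous_attains_inf[of "cball z R" F] by auto
  have "F m \<le> F y" for y
  proof (cases "y \<in> cball z R")
    case False
    then have "R < norm (z - y)" by (simp add: dist_norm)
    then have "R\<^sup>2 < (norm (z - y))\<^sup>2" using R(1) by (simp add: power_strict_mono)
    then have "F z \<le> F y" using R(2) F_ge[of y] by simp
    moreover have "F m \<le> F z" using m R(1) by simp
    ultimately show ?thesis by simp
  qed (use m in blast)
  then have "is_arg_min F (\<lambda>x. True) m" by (auto simp: is_arg_min_def not_less)
  then have "is_arg_min F (\<lambda>x. True) (arg_min F (\<lambda>x. True))"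
    unfolding arg_min_def by (rule someI)
  then have "F (denoise C lam z) \<le> F x"
    unfolding denoise_def F_def[abs_def] by (auto simp: is_arg_min_def not_less)
  then show ?thesis by (simp add: F_def)
qed

text \<open>This is the optimality condition that \<open>z - denoise C lam z\<close> is a
  subgradient of \<open>lam\<close> times the gauge at the minimiser. It follows by moving from the
  minimiser a fraction \<open>u\<close> of the way towards \<open>y\<close>, dividing by
  \<open>u\<close> and letting \<open>u\<close> tend to 0.\<close>

lemma denoise_variational:
  fixes C :: "(real ^ 'p) set"
  assumes C: "gauge_body C" and lam: "lam \<ge> 0"
  shows "(z - denoise C lam z) \<bullet> (y - denoise C lam z) + lam * minkowski_gauge C (denoise C lam z)
    \<le> lam * minkowski_gauge C y"
proof -
  interpret gauge_body C by fact
  define x where "x = denoise C lam z"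
  define d where "d = y - x"
  have step: "(z - x) \<bullet> d + lam * G x \<le> lam * G y + u * ((norm d)\<^sup>2 / 2)" if u: "0 < u" "u \<le> 1" for u
  proof -
    have "x + u *\<^sub>R d = (1 - u) *\<^sub>R x + u *\<^sub>R y"
      by (simp add: d_def algebra_simps)
    then have "G (x + u *\<^sub>R d) \<le> (1 - u) * G x + u * G y"
      using gauge_convex[of u x y] u by simp
    then have "lam * G (x + u *\<^sub>R d) \<le> lam * ((1 - u) * G x + u * G y)"
      using lam by (rule mult_left_mono)
    moreover have "1 / 2 * (norm (z - x))\<^sup>2 + lam * G x
        \<le> 1 / 2 * (norm (z - (x + u *\<^sub>R d)))\<^sup>2 + lam * G (x + u *\<^sub>R d)"
      unfolding x_def by (rule denoise_is_arg_min[OF C lam])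
    moreover have "(norm (z - (x + u *\<^sub>R d)))\<^sup>2 = (norm (z - x))\<^sup>2 - 2 * u * ((z - x) \<bullet> d) + u\<^sup>2 * (norm d)\<^sup>2"
      unfolding power2_norm_eq_inner by (simp add: inner_simps inner_commute algebra_simps power2_eq_square)
    ultimately have "u * ((z - x) \<bullet> d + lam * G x) \<le> u * (lam * G y + u * ((norm d)\<^sup>2 / 2))"
      by (simp add: algebra_simps power2_eq_square)
    then show ?thesis using u by simp
  qed
  have "(z - x) \<bullet> d + lam * G x \<le> lam * G y"
  proof (rule field_le_epsilon)
    fix e :: real assume e: "e > 0"
    \<comment> \<open>The summand 1 keeps \<open>q\<close> positive also when \<open>d = 0\<close>,
      so that \<open>e / q\<close> is a valid bound for \<open>u\<close>.\<close>
    define q where "q = (norm d)\<^sup>2 / 2 + 1"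
    have q: "q > 0" by (simp add: q_def add_nonneg_pos)
    define u where "u = min 1 (e / q)"
    have u: "0 < u" "u \<le> 1" "u \<le> e / q" using e q by (auto simp: u_def)
    have "u * ((norm d)\<^sup>2 / 2) \<le> (e / q) * q"
      using u e q by (intro mult_mono) (auto simp: q_def)
    then have "u * ((norm d)\<^sup>2 / 2) \<le> e" using q by simp
    then show "(z - x) \<bullet> d + lam * G x \<le> lam * G y + e" using step[OF u(1,2)] by linarith
  qed
  then show ?thesis by (simp add: x_def d_def)
qed

text \<open>The variational inequality at each of the two minimisers is tested at the other one. In
  the sum the gauge terms cancel, and Cauchy-Schwarz finishes.\<close>

lemma denoise_nonexpansive:
  fixes C :: "(real ^ 'p) set"
  assumes C: "gauge_body C" and lam: "lam \<ge> 0"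
  shows "norm (denoise C lam z - denoise C lam w) \<le> norm (z - w)"
proof -
  define x y where "x = denoise C lam z" and "y = denoise C lam w"
  have "(z - x) \<bullet> (y - x) + (w - y) \<bullet> (x - y) \<le> 0"
    using denoise_variational[OF C lam, of z y] denoise_variational[OF C lam, of w x]
    unfolding x_def y_def by linarith
  then have "(norm (x - y))\<^sup>2 \<le> (z - w) \<bullet> (x - y)"
    unfolding power2_norm_eq_inner by (simp add: inner_simps inner_commute algebra_simps)
  also have "\<dots> \<le> norm (z - w) * norm (x - y)" by (rule norm_cauchy_schwarz)
  finally have "norm (x - y) * norm (x - y) \<le> norm (z - w) * norm (x - y)"
    by (simp add: power2_eq_square)
  then show ?thesis
    by (cases "x = y") (auto simp: x_def y_def)
qed

text \<open>For any subgradient \<open>v\<close> at the true signal \<open>x\<close>, the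
  subgradient inequality and the variational inequality tested at \<open>x\<close> cancel the gauge
  terms. This leaves the squared error below the inner product of \<open>z - lam *\<^sub>R v\<close>
  with the error, and \<open>v\<close> is then optimised.\<close>

lemma denoise_error:
  fixes C :: "(real ^ 'p) set"
  assumes C: "gauge_body C" and lam: "lam \<ge> 0"
  shows "norm (denoise C lam (x + z) - x) \<le> infdist z ((\<lambda>v. lam *\<^sub>R v) ` subdifferential (minkowski_gauge C) x)"
proof -
  interpret gauge_body C by fact
  define y where "y = denoise C lam (x + z)"
  have "norm (y - x) \<le> dist z (lam *\<^sub>R v)" if v: "v \<in> subdifferential G x" for v
  proof -
    have "lam * (G x + v \<bullet> (y - x)) \<le> lam * G y"
      using v lam unfolding subdifferential_def by (intro mult_left_mono) auto
    moreover have "(x + z - y) \<bullet> (x - y) + lam * G y \<le> lam * G x"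
      unfolding y_def by (rule denoise_variational[OF C lam])
    ultimately have "(norm (y - x))\<^sup>2 \<le> (z - lam *\<^sub>R v) \<bullet> (y - x)"
      unfolding power2_norm_eq_inner by (simp add: inner_simps inner_commute algebra_simps)
    also have "\<dots> \<le> norm (z - lam *\<^sub>R v) * norm (y - x)" by (rule norm_cauchy_schwarz)
    finally have "norm (y - x) * norm (y - x) \<le> norm (z - lam *\<^sub>R v) * norm (y - x)"
      by (simp add: power2_eq_square)
    then show ?thesis by (cases "y = x") (auto simp: dist_norm)
  qed
  then show ?thesis
    using subdifferential_gauge_nonempty[of x]
    by (auto simp: infdist_def y_def intro!: cINF_greatest)
qed

subsection \<open>Windowed Gaussian noise\<close>

context prob_space
begin

lemma indep_var_disjoint_sums:
  fixes X :: "'i \<Rightarrow> 'a \<Rightarrow> 'b::euclidean_space"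
  assumes indep: "indep_vars (\<lambda>_. borel) X I"
    and AB: "A \<inter> B = {}" "A \<subseteq> I" "B \<subseteq> I"
  shows "indep_var borel (\<lambda>\<omega>. \<Sum>i\<in>A. X i \<omega>) borel (\<lambda>\<omega>. \<Sum>i\<in>B. X i \<omega>)"
proof -
  have m: "(\<lambda>f. \<Sum>i\<in>J. f i) \<in> borel_measurable (PiM J (\<lambda>_::'i. borel :: 'b measure))" for J
    by (intro borel_measurable_sum measurable_component_singleton)
  have "indep_var
    borel ((\<lambda>f. \<Sum>i\<in>A. f i) \<circ> (\<lambda>\<omega>. restrict (\<lambda>i. X i \<omega>) A))
    borel ((\<lambda>f. \<Sum>i\<in>B. f i) \<circ> (\<lambda>\<omega>. restrict (\<lambda>i. X i \<omega>) B))"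
    by (rule indep_var_compose[OF indep_var_restrict[OF indep AB] m m])
  moreover have "((\<lambda>f. \<Sum>i\<in>J. f i) \<circ> (\<lambda>\<omega>. restrict (\<lambda>i. X i \<omega>) J)) = (\<lambda>\<omega>. \<Sum>i\<in>J. X i \<omega>)" for J
    by (auto simp: fun_eq_iff intro!: sum.cong)
  ultimately show ?thesis by simp
qed

lemma distr_add_iso_gaussian:
  fixes X Y :: "'a \<Rightarrow> real ^ 'p::finite"
  assumes indep: "indep_var borel X borel Y" and ab: "a > 0" "b > 0"
    and X: "distr M borel X = iso_gaussian a" and Y: "distr M borel Y = iso_gaussian b"
  shows "distr M borel (\<lambda>\<omega>. X \<omega> + Y \<omega>) = iso_gaussian (sqrt (a\<^sup>2 + b\<^sup>2))"
proof -
  have [measurable]: "X \<in> borel_measurable M" "Y \<in> borel_measurable M"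
    and eq: "iso_gaussian a \<Otimes>\<^sub>M iso_gaussian b = distr M (borel \<Otimes>\<^sub>M borel) (\<lambda>\<omega>. (X \<omega>, Y \<omega>))"
    using indep unfolding indep_var_distribution_eq X Y by auto
  show ?thesis
    unfolding iso_gaussian_convolution[OF ab, symmetric] eq by (subst distr_distr) (auto simp: comp_def)
qed

lemma distr_sum_iso_gaussian:
  fixes X :: "'i \<Rightarrow> 'a \<Rightarrow> real ^ 'p::finite"
  assumes "finite J" "J \<noteq> {}" and s: "s > 0"
    and "indep_vars (\<lambda>_. borel) X J" and "\<And>i. i \<in> J \<Longrightarrow> distr M borel (X i) = iso_gaussian s"
  shows "distr M borel (\<lambda>\<omega>. \<Sum>i\<in>J. X i \<omega>) = iso_gaussian (s * sqrt (card J))"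
  using assms(1,2,4,5)
proof (induction J rule: finite_ne_induct)
  case (singleton i)
  then show ?case by simp
next
  case (insert i J)
  have "indep_var borel (\<lambda>\<omega>. \<Sum>i\<in>{i}. X i \<omega>) borel (\<lambda>\<omega>. \<Sum>i\<in>J. X i \<omega>)"
    using insert.hyps by (intro indep_var_disjoint_sums[OF insert.prems(1)]) auto
  then have ind: "indep_var borel (X i) borel (\<lambda>\<omega>. \<Sum>i\<in>J. X i \<omega>)" by simp
  have "card J > 0" using insert.hyps by (simp add: card_gt_0_iff)
  then have pos: "s * sqrt (card J) > 0" using s by simp
  have "indep_vars (\<lambda>_. borel) X J"
    by (rule indep_vars_subset[OF insert.prems(1)]) auto
  then have J: "distr M borel (\<lambda>\<omega>. \<Sum>i\<in>J. X i \<omega>) = iso_gaussian (s * sqrt (card J))"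
    by (rule insert.IH) (use insert.prems(2) in auto)
  have "sqrt (s\<^sup>2 + (s * sqrt (card J))\<^sup>2) = s * sqrt (card (insert i J))"
    using insert.hyps s by (intro real_sqrt_unique) (auto simp: power_mult_distrib algebra_simps)
  then show ?case
    using distr_add_iso_gaussian[OF ind s pos _ J] insert.prems(2)[of i] insert.hyps by simp
qed

text \<open>The sum over a window has scale \<open>\<sigma> * sqrt \<theta>\<close>, so its average
  has scale \<open>\<sigma> / sqrt \<theta>\<close>, which the prefactor normalises to 1.\<close>

lemma filtered_noise_std_gaussian:
  fixes \<epsilon> :: "nat \<Rightarrow> 'a \<Rightarrow> real ^ 'p::finite"
  assumes \<sigma>: "\<sigma> > 0" and \<theta>: "\<theta> \<ge> 1"
    and indep: "indep_vars (\<lambda>_. borel) \<epsilon> {i..i + \<theta> - 1}"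
    and dist: "\<And>t. t \<in> {i..i + \<theta> - 1} \<Longrightarrow> distr M borel (\<epsilon> t) = iso_gaussian \<sigma>"
  shows "distr M borel (\<lambda>\<omega>. (sqrt \<theta> / \<sigma>) *\<^sub>R filtered \<theta> (\<lambda>t. \<epsilon> t \<omega>) i) = std_gaussian"
proof -
  let ?J = "{i..i + \<theta> - 1}"
  define s where "s = \<sigma> * sqrt \<theta>"
  have s: "s > 0" using \<sigma> \<theta> by (simp add: s_def)
  have c: "card ?J = \<theta>" using \<theta> by simp
  have [measurable]: "\<epsilon> t \<in> borel_measurable M" if "t \<in> ?J" for t
    using indep that by (auto simp: indep_vars_def)
  have m: "(\<lambda>\<omega>. \<Sum>t\<in>?J. \<epsilon> t \<omega>) \<in> borel_measurable M" by (intro borel_measurable_sum) auto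
  have sum: "distr M borel (\<lambda>\<omega>. \<Sum>t\<in>?J. \<epsilon> t \<omega>) = distr std_gaussian borel (\<lambda>x. s *\<^sub>R x)"
    using distr_sum_iso_gaussian[OF _ _ \<sigma> indep dist] \<theta> s unfolding c s_def[symmetric]
    by (subst iso_gaussian_scale[symmetric]) auto
  have "sqrt \<theta> / \<sigma> * (1 / \<theta>) = inverse s"
    using \<sigma> \<theta> by (simp add: s_def field_simps flip: real_sqrt_mult)
  then have "(\<lambda>\<omega>. (sqrt \<theta> / \<sigma>) *\<^sub>R filtered \<theta> (\<lambda>t. \<epsilon> t \<omega>) i) = (\<lambda>x. inverse s *\<^sub>R x) \<circ> (\<lambda>\<omega>. \<Sum>t\<in>?J. \<epsilon> t \<omega>)"
    by (simp add: filtered_def fun_eq_iff)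
  then have "distr M borel (\<lambda>\<omega>. (sqrt \<theta> / \<sigma>) *\<^sub>R filtered \<theta> (\<lambda>t. \<epsilon> t \<omega>) i)
    = distr (distr M borel (\<lambda>\<omega>. \<Sum>t\<in>?J. \<epsilon> t \<omega>)) borel (\<lambda>x. inverse s *\<^sub>R x)"
    using m by (subst distr_distr) auto
  also have "\<dots> = distr std_gaussian borel (\<lambda>x. x)"
    unfolding sum using s by (subst distr_distr) (auto simp: comp_def)
  also have "\<dots> = std_gaussian" by (rule distr_id2) simp
  finally show ?thesis .
qed

text \<open>Chernoff bound for the sum with exponent parameter \<open>u\<close>, which minimises
  \<open>\<kappa>\<^sup>2 - 2 * \<kappa> * u\<close>. By independence the two moment bounds multiply
  to \<open>exp (2 * u * m + u\<^sup>2)\<close>. Bounding the two distances one at a time would give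
  only \<open>exp (- u\<^sup>2 / 2)\<close> for each.\<close>

lemma gaussian_pair_tail:
  fixes Z1 Z2 :: "'a \<Rightarrow> real ^ 'p::finite" and d1 d2 :: "real ^ 'p \<Rightarrow> real"
  assumes indep: "indep_var borel Z1 borel Z2"
    and Z1: "distr M borel Z1 = std_gaussian" and Z2: "distr M borel Z2 = std_gaussian"
    and lip: "1-lipschitz_on UNIV d1" "1-lipschitz_on UNIV d2"
    and m: "(\<integral>x. d1 x \<partial>std_gaussian) \<le> m" "(\<integral>x. d2 x \<partial>std_gaussian) \<le> m"
    and u: "u > 0"
  shows "prob {\<omega> \<in> space M. d1 (Z1 \<omega>) + d2 (Z2 \<omega>) > 2 * (m + u)} \<le> exp (- u\<^sup>2)"
proof -
  have [measurable]: "Z1 \<in> borel_measurable M" "Z2 \<in> borel_measurable M"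
    using indep indep_var_rv1 indep_var_rv2 by blast+
  note [measurable] = borel_measurable_lipschitz[OF lip(1)] borel_measurable_lipschitz[OF lip(2)]
  define e1 e2 where "e1 x = exp (u * d1 x)" and "e2 x = exp (u * d2 x)" for x
  have [measurable]: "e1 \<in> borel_measurable borel" "e2 \<in> borel_measurable borel"
    unfolding e1_def[abs_def] e2_def[abs_def] by measurable
  have ind: "indep_var borel (\<lambda>\<omega>. e1 (Z1 \<omega>)) borel (\<lambda>\<omega>. e2 (Z2 \<omega>))"
    using indep_var_compose[OF indep, of e1 borel e2 borel] by (simp add: comp_def)
  note mgf1 = gaussian_mgf_lipschitz[OF lip(1) less_imp_le[OF u]]
  note mgf2 = gaussian_mgf_lipschitz[OF lip(2) less_imp_le[OF u]]
  have int1: "integrable M (\<lambda>\<omega>. e1 (Z1 \<omega>))"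
    using mgf1(1) unfolding Z1[symmetric] e1_def[symmetric] by (subst (asm) integrable_distr_eq) auto
  have int2: "integrable M (\<lambda>\<omega>. e2 (Z2 \<omega>))"
    using mgf2(1) unfolding Z2[symmetric] e2_def[symmetric] by (subst (asm) integrable_distr_eq) auto
  have le1: "(\<integral>\<omega>. e1 (Z1 \<omega>) \<partial>M) \<le> exp (u * m + u\<^sup>2 / 2)"
  proof -
    have "(\<integral>\<omega>. e1 (Z1 \<omega>) \<partial>M) = (\<integral>x. exp (u * d1 x) \<partial>std_gaussian)"
      unfolding Z1[symmetric] e1_def[symmetric] by (subst integral_distr) auto
    also have "\<dots> \<le> exp (u * (\<integral>x. d1 x \<partial>std_gaussian) + u\<^sup>2 / 2)" by (rule mgf1(3))
    also have "\<dots> \<le> exp (u * m + u\<^sup>2 / 2)" using u m by simp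
    finally show ?thesis .
  qed
  have le2: "(\<integral>\<omega>. e2 (Z2 \<omega>) \<partial>M) \<le> exp (u * m + u\<^sup>2 / 2)"
  proof -
    have "(\<integral>\<omega>. e2 (Z2 \<omega>) \<partial>M) = (\<integral>x. exp (u * d2 x) \<partial>std_gaussian)"
      unfolding Z2[symmetric] e2_def[symmetric] by (subst integral_distr) auto
    also have "\<dots> \<le> exp (u * (\<integral>x. d2 x \<partial>std_gaussian) + u\<^sup>2 / 2)" by (rule mgf2(3))
    also have "\<dots> \<le> exp (u * m + u\<^sup>2 / 2)" using u m by simp
    finally show ?thesis .
  qed
  let ?W = "\<lambda>\<omega>. e1 (Z1 \<omega>) * e2 (Z2 \<omega>)"
  have intW: "integrable M ?W" by (rule indep_var_integrable[OF ind int1 int2])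
  have "prob {\<omega> \<in> space M. d1 (Z1 \<omega>) + d2 (Z2 \<omega>) > 2 * (m + u)}
    \<le> prob {\<omega> \<in> space M. ?W \<omega> \<ge> exp (u * (2 * (m + u)))}"
  proof (rule finite_measure_mono)
    show "{\<omega> \<in> space M. d1 (Z1 \<omega>) + d2 (Z2 \<omega>) > 2 * (m + u)} \<subseteq> {\<omega> \<in> space M. ?W \<omega> \<ge> exp (u * (2 * (m + u)))}"
    proof safe
      fix \<omega> assume "2 * (m + u) < d1 (Z1 \<omega>) + d2 (Z2 \<omega>)"
      then have "u * (2 * (m + u)) \<le> u * (d1 (Z1 \<omega>) + d2 (Z2 \<omega>))"
        using u by (intro mult_left_mono) auto
      then show "exp (u * (2 * (m + u))) \<le> ?W \<omega>"
        by (simp add: e1_def e2_def distrib_left flip: exp_add)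
    qed
  qed measurable
  also have "\<dots> \<le> (\<integral>\<omega>. ?W \<omega> \<partial>M) / exp (u * (2 * (m + u)))"
    by (rule integral_Markov_inequality_measure[OF intW sets.empty_sets]) (auto simp: e1_def e2_def)
  also have "(\<integral>\<omega>. ?W \<omega> \<partial>M) = (\<integral>\<omega>. e1 (Z1 \<omega>) \<partial>M) * (\<integral>\<omega>. e2 (Z2 \<omega>) \<partial>M)"
    by (rule indep_var_lebesgue_integral[OF ind int1 int2])
  also have "\<dots> \<le> exp (u * m + u\<^sup>2 / 2) * exp (u * m + u\<^sup>2 / 2)"
    by (intro mult_mono le1 le2 integral_nonneg_AE) (auto simp: e1_def e2_def)
  also have "\<dots> / exp (u * (2 * (m + u))) = exp (- u\<^sup>2)"
    by (simp add: power2_eq_square algebra_simps flip: exp_add exp_diff)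
  finally show ?thesis by (simp add: divide_right_mono)
qed

end

lemma lipschitz_infdist: "1-lipschitz_on UNIV (\<lambda>x. infdist x A)"
  by (rule lipschitz_onI) (use infdist_triangle_abs[of _ A] in \<open>auto simp: dist_real_def\<close>)

text \<open>A vanishing mean would put almost every point in the closure of \<open>K\<close>. The
  Gaussian density is positive, so this holds for Lebesgue measure as well, and a closed set of full
  measure is the whole space, against boundedness.\<close>

lemma integral_infdist_std_gaussian_pos:
  fixes K :: "(real ^ 'p::finite) set"
  assumes "bounded K" "K \<noteq> {}"
  shows "0 < (\<integral>x. infdist x K \<partial>std_gaussian)"
proof (rule ccontr)
  have int: "integrable std_gaussian (\<lambda>x. infdist x K)"
    by (rule gaussian_mgf_lipschitz(2)[OF lipschitz_infdist, of 0]) simp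
  assume "\<not> ?thesis"
  moreover have "0 \<le> (\<integral>x. infdist x K \<partial>std_gaussian)" by (simp add: infdist_nonneg)
  ultimately have "(\<integral>x. infdist x K \<partial>std_gaussian) = 0" by linarith
  then have "AE x in std_gaussian. infdist x K = 0"
    using integral_nonneg_eq_0_iff_AE[OF int] by (simp add: infdist_nonneg)
  then have "AE x in lborel. iso_normal_density 1 x > 0 \<longrightarrow> infdist x K = 0"
    unfolding std_gaussian_def by (subst (asm) AE_density) auto
  moreover have "iso_normal_density 1 x > 0" for x :: "real ^ 'p"
    by (auto simp: iso_normal_density_def intro!: prod_pos normal_density_pos)
  ultimately have "AE x in lborel. x \<in> closure K"
    using assms(2) by (auto simp: in_closure_iff_infdist_zero)
  then have "AE x in lebesgue. x \<in> closure K" by (rule AE_completion)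
  then have "x \<in> closure K" for x by (rule mem_closed_if_AE_lebesgue[OF closed_closure])
  then have "bounded (UNIV :: (real ^ 'p) set)"
    using bounded_closure[OF assms(1)] by (metis UNIV_eq_I)
  then show False using not_bounded_UNIV by blast
qed

subsection \<open>The algorithm on a good event\<close>

text \<open>Hop from \<open>a\<close> to the next element of \<open>A\<close> until \<open>b\<close>
  is reached; no hop is longer than \<open>b - a\<close>.\<close>

lemma close_consecutive_chain:
  assumes "finite A" "a \<in> A" "b \<in> A" "a \<le> b" "b - a \<le> \<theta>"
  shows "(a, b) \<in> (close_consecutive \<theta> A)\<^sup>*"
  using assms(2,4,5)
proof (induction "b - a" arbitrary: a rule: less_induct)
  case less
  show ?case
  proof (cases "a = b")
    case False
    with less.prems have ab: "a < b" by simp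
    define c where "c = Min {u \<in> A. a < u}"
    have fin: "finite {u \<in> A. a < u}" using assms(1) by simp
    have ne: "{u \<in> A. a < u} \<noteq> {}" using ab assms(3) by blast
    have c: "c \<in> A" "a < c" using Min_in[OF fin ne] by (auto simp: c_def)
    have cle: "c \<le> u" if "u \<in> A" "a < u" for u
      unfolding c_def using fin that by (intro Min_le) auto
    have cb: "c \<le> b" using cle ab assms(3) by blast
    have "\<not> (a < u \<and> u < c)" if "u \<in> A" for u
      using cle[OF that] by linarith
    then have "(a, c) \<in> close_consecutive \<theta> A"
      using less.prems c cb by (auto simp: close_consecutive_def)
    moreover have "(c, b) \<in> (close_consecutive \<theta> A)\<^sup>*"
      using less.prems c cb by (intro less.hyps) auto
    ultimately show ?thesis by (rule converse_rtrancl_into_rtrancl)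
  qed simp
qed

text \<open>All members of a neighbourhood are chained to its centre, hence to each other.
  Conversely no link of length at most \<theta> leads into a neighbourhood with another centre,
  because centres are at least 3\<theta> apart.\<close>

lemma index_groups_eq_neighbourhoods:
  assumes A: "finite A" and sub: "\<tau> \<subseteq> A"
    and near: "\<And>t. t \<in> A \<Longrightarrow> \<exists>s\<in>\<tau>. \<bar>int t - int s\<bar> < int \<theta>"
    and sep: "\<And>s t. s \<in> \<tau> \<Longrightarrow> t \<in> \<tau> \<Longrightarrow> s \<noteq> t \<Longrightarrow> 3 * int \<theta> \<le> \<bar>int s - int t\<bar>"
  shows "index_groups \<theta> A = (\<lambda>s. {t \<in> A. \<bar>int t - int s\<bar> < int \<theta>}) ` \<tau>"
proof -
  define R where "R = close_consecutive \<theta> A \<union> (close_consecutive \<theta> A)\<inverse>"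
  have "sym R" by (auto simp: R_def sym_def)
  then have symR: "(y, x) \<in> R\<^sup>*" if "(x, y) \<in> R\<^sup>*" for x y
    using symD[OF sym_rtrancl] that by fast
  have chain: "(a, b) \<in> R\<^sup>*" if "a \<in> A" "b \<in> A" "\<bar>int a - int b\<bar> < int \<theta>" for a b
  proof (cases "a \<le> b")
    case True
    have "(a, b) \<in> (close_consecutive \<theta> A)\<^sup>*"
      using that True by (intro close_consecutive_chain[OF A]) auto
    then show ?thesis using rtrancl_mono[of "close_consecutive \<theta> A" R] by (auto simp: R_def)
  next
    case False
    have "(b, a) \<in> (close_consecutive \<theta> A)\<^sup>*"
      using that False by (intro close_consecutive_chain[OF A]) auto
    then have "(b, a) \<in> R\<^sup>*" using rtrancl_mono[of "close_consecutive \<theta> A" R] by (auto simp: R_def)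
    then show ?thesis by (rule symR)
  qed
  have R_A: "x \<in> A \<and> y \<in> A \<and> \<bar>int x - int y\<bar> \<le> int \<theta>" if "(x, y) \<in> R" for x y
    using that by (auto simp: R_def close_consecutive_def)
  have stay: "y \<in> A \<and> \<bar>int y - int s\<bar> < int \<theta>"
    if "(x, y) \<in> R\<^sup>*" "x \<in> A" "\<bar>int x - int s\<bar> < int \<theta>" "s \<in> \<tau>" for x y s
    using that(1)
  proof (induction rule: rtrancl_induct)
    case (step y z)
    from R_A[OF step.hyps(2)] have yz: "z \<in> A" "\<bar>int y - int z\<bar> \<le> int \<theta>" by auto
    obtain s' where s': "s' \<in> \<tau>" "\<bar>int z - int s'\<bar> < int \<theta>" using near[OF yz(1)] by blast
    \<comment> \<open>\<open>y\<close> and \<open>z\<close> are at most \<theta> apart, and each is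
      less than \<theta> from its centre; so the centres are less than 3\<theta> apart and must
      coincide.\<close>
    have "s' = s"
      using sep[OF s'(1) that(4)] s'(2) yz(2) step.IH by linarith
    with s' yz show ?case by simp
  qed (use that in auto)
  have cls: "R\<^sup>* `` {x} = {t \<in> A. \<bar>int t - int s\<bar> < int \<theta>}"
    if "x \<in> A" "\<bar>int x - int s\<bar> < int \<theta>" "s \<in> \<tau>" for x s
  proof
    show "R\<^sup>* `` {x} \<subseteq> {t \<in> A. \<bar>int t - int s\<bar> < int \<theta>}"
      using stay that by auto
    show "{t \<in> A. \<bar>int t - int s\<bar> < int \<theta>} \<subseteq> R\<^sup>* `` {x}"
    proof
      fix t assume "t \<in> {t \<in> A. \<bar>int t - int s\<bar> < int \<theta>}"
      then have t: "t \<in> A" "\<bar>int t - int s\<bar> < int \<theta>" by auto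
      have s: "s \<in> A" using sub that by blast
      have "(x, s) \<in> R\<^sup>*" by (rule chain[OF that(1) s that(2)])
      also have "(s, t) \<in> R\<^sup>*" by (rule symR[OF chain[OF t(1) s t(2)]])
      finally show "t \<in> R\<^sup>* `` {x}" by simp
    qed
  qed
  show ?thesis
  proof
    show "index_groups \<theta> A \<subseteq> (\<lambda>s. {t \<in> A. \<bar>int t - int s\<bar> < int \<theta>}) ` \<tau>"
    proof
      fix g assume "g \<in> index_groups \<theta> A"
      then obtain x where x: "x \<in> A" "g = R\<^sup>* `` {x}"
        unfolding index_groups_def R_def[symmetric] by (auto simp: quotient_def)
      obtain s where "s \<in> \<tau>" "\<bar>int x - int s\<bar> < int \<theta>" using near[OF x(1)] by blast
      with cls[OF x(1)] x(2) show "g \<in> (\<lambda>s. {t \<in> A. \<bar>int t - int s\<bar> < int \<theta>}) ` \<tau>" by blast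
    qed
    show "(\<lambda>s. {t \<in> A. \<bar>int t - int s\<bar> < int \<theta>}) ` \<tau> \<subseteq> index_groups \<theta> A"
    proof safe
      fix s assume s: "s \<in> \<tau>"
      from near[OF subsetD[OF sub s]] have "int \<theta> > 0" by fastforce
      then have "R\<^sup>* `` {s} = {t \<in> A. \<bar>int t - int s\<bar> < int \<theta>}"
        using s sub by (intro cls) auto
      then show "{t \<in> A. \<bar>int t - int s\<bar> < int \<theta>} \<in> index_groups \<theta> A"
        unfolding index_groups_def R_def[symmetric] using s sub by (auto simp: quotient_def)
    qed
  qed
qed

lemma sorted_list_of_set_image_strict_mono_on:
  fixes m :: "nat \<Rightarrow> nat"
  assumes "finite A" "strict_mono_on A m"
  shows "sorted_list_of_set (m ` A) = map m (sorted_list_of_set A)"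
proof (rule sorted_list_of_set_unique[THEN iffD1])
  have mono: "m x < m y" if "x \<in> A" "y \<in> A" "x < y" for x y
    using assms(2) that by (auto simp: strict_mono_on_def)
  have inj: "inj_on m A" by (rule strict_mono_on_imp_inj_on[OF assms(2)])
  show "finite (m ` A)" using assms(1) by simp
  have "sorted_wrt (\<lambda>x y. m x < m y) (sorted_list_of_set A)"
    by (rule sorted_wrt_mono_rel[OF _ strict_sorted_list_of_set]) (use assms mono in auto)
  then show "sorted_wrt (<) (map m (sorted_list_of_set A)) \<and> set (map m (sorted_list_of_set A)) = m ` A
    \<and> length (map m (sorted_list_of_set A)) = card (m ` A)"
    using assms(1) inj by (simp add: sorted_wrt_map card_image)
qed

text \<open>The centre \<open>s\<close> belongs to its own group, so the selected index
  \<open>m s\<close> satisfies \<open>S s \<le> S (m s)\<close> and falls under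
  \<open>bound\<close>. Separation makes \<open>m\<close> strictly increasing, so the
  \<open>i\<close>-th selected index belongs to the \<open>i\<close>-th element of \<tau>.\<close>

lemma selection_near_change_points:
  assumes sel: "is_selection S (index_groups \<theta> A) T"
    and A: "finite A" and sub: "\<tau> \<subseteq> A"
    and near: "\<And>t. t \<in> A \<Longrightarrow> \<exists>s\<in>\<tau>. \<bar>int t - int s\<bar> < int \<theta>"
    and sep: "\<And>s t. s \<in> \<tau> \<Longrightarrow> t \<in> \<tau> \<Longrightarrow> s \<noteq> t \<Longrightarrow> 3 * int \<theta> \<le> \<bar>int s - int t\<bar>"
    and bound: "\<And>s t. s \<in> \<tau> \<Longrightarrow> t \<in> A \<Longrightarrow> \<bar>int t - int s\<bar> < int \<theta> \<Longrightarrow> S s \<le> S t \<Longrightarrow> \<bar>real t - real s\<bar> \<le> b"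
  shows "card T = card \<tau> \<and> (\<forall>i < card \<tau>. \<bar>real (sorted_list_of_set T ! i) - real (sorted_list_of_set \<tau> ! i)\<bar> \<le> b)"
proof -
  define N where "N s = {t \<in> A. \<bar>int t - int s\<bar> < int \<theta>}" for s
  have groups: "index_groups \<theta> A = N ` \<tau>"
    unfolding N_def by (rule index_groups_eq_neighbourhoods[OF A sub near sep])
  obtain f where f: "\<And>g. g \<in> N ` \<tau> \<Longrightarrow> is_arg_max S (\<lambda>t. t \<in> g) (f g)" and T: "T = f ` N ` \<tau>"
    using sel unfolding is_selection_def groups by blast
  define m where "m s = f (N s)" for s
  have mT: "T = m ` \<tau>" by (simp add: T m_def image_image)
  have mN: "m s \<in> N s" "\<not> S (m s) < S t" if "s \<in> \<tau>" "t \<in> N s" for s t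
    using f[of "N s"] that by (auto simp: m_def is_arg_max_def)
  have self: "s \<in> N s" if "s \<in> \<tau>" for s
    using near that sub by (force simp: N_def)
  have m: "m s \<in> A" "\<bar>int (m s) - int s\<bar> < int \<theta>" "S s \<le> S (m s)" if "s \<in> \<tau>" for s
    using mN[OF that self[OF that]] by (auto simp: N_def)
  have fin: "finite \<tau>" using A sub by (rule finite_subset[rotated])
  have mono: "strict_mono_on \<tau> m"
  proof (rule strict_mono_onI)
    fix s t assume st: "s \<in> \<tau>" "t \<in> \<tau>" "s < t"
    then show "m s < m t" using sep[OF st(1,2)] m(2)[OF st(1)] m(2)[OF st(2)] by linarith
  qed
  have "card T = card \<tau>"
    unfolding mT by (rule card_image[OF strict_mono_on_imp_inj_on[OF mono]])
  moreover have "\<bar>real (sorted_list_of_set T ! i) - real (sorted_list_of_set \<tau> ! i)\<bar> \<le> b" if "i < card \<tau>" for i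
  proof -
    have i: "i < length (sorted_list_of_set \<tau>)" using that by simp
    then have "sorted_list_of_set \<tau> ! i \<in> \<tau>" using nth_mem[OF i] fin by simp
    then show ?thesis
      unfolding mT sorted_list_of_set_image_strict_mono_on[OF fin mono] using i m by (auto intro!: bound)
  qed
  ultimately show ?thesis by blast
qed

section \<open>Filtering a piecewise constant signal\<close>

lemma finite_change_points: "finite (change_points n X)"
  by (rule finite_subset[of _ "{..n}"]) (auto simp: change_points_def)

lemma constant_between_change_points:
  assumes "1 \<le> a" "a \<le> b" "b \<le> n" "\<And>t. a \<le> t \<Longrightarrow> t < b \<Longrightarrow> t \<notin> change_points n X"
  shows "X b = X a"
  using assms(2,3,4)
proof (induction b rule: dec_induct)
  case (step k)
  then have "X k = X a" by simp
  moreover have "k \<notin> change_points n X" using step by simp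
  then have "X (k + 1) = X k" using step assms(1) by (auto simp: change_points_def)
  ultimately show ?case by simp
qed simp

lemma filtered_add:
  assumes "\<And>t. t \<in> {i..i + \<theta> - 1} \<Longrightarrow> y t = x t + e t"
  shows "filtered \<theta> y i = filtered \<theta> x i + filtered \<theta> e i"
proof -
  have "(\<Sum>t = i..i + \<theta> - 1. y t) = (\<Sum>t = i..i + \<theta> - 1. x t + e t)"
    using assms by (rule sum.cong[OF refl])
  then show ?thesis by (simp add: filtered_def sum.distrib scaleR_add_right)
qed

text \<open>Only samples in \<open>K\<close> can deviate from \<open>b\<close>, each contributing
  \<open>norm (a - b) / \<theta>\<close> to the average. This is the bias of a window that straddles
  a change-point.\<close>

lemma norm_filtered_diff_le:
  fixes X :: "nat \<Rightarrow> real ^ 'p"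
  assumes \<theta>: "\<theta> \<ge> 1" and K: "finite K"
    and X: "\<And>t. t \<in> {i..i + \<theta> - 1} \<Longrightarrow> X t = b \<or> t \<in> K \<and> X t = a"
  shows "norm (filtered \<theta> X i - b) \<le> card K / \<theta> * norm (a - b)"
proof -
  let ?J = "{i..i + \<theta> - 1}"
  have "(\<Sum>t\<in>?J. X t - b) = (\<Sum>t\<in>?J. X t) - \<theta> *\<^sub>R b"
    using \<theta> by (simp add: sum_subtractf sum_constant_scaleR del: sum_constant)
  then have "filtered \<theta> X i - b = (1 / \<theta>) *\<^sub>R (\<Sum>t\<in>?J. X t - b)"
    using \<theta> by (simp add: filtered_def scaleR_diff_right)
  also have "norm \<dots> \<le> 1 / \<theta> * (\<Sum>t\<in>?J. norm (X t - b))"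
    by (simp add: divide_right_mono norm_sum)
  also have "(\<Sum>t\<in>?J. norm (X t - b)) \<le> (\<Sum>t\<in>?J. if t \<in> K then norm (a - b) else 0)"
    using X by (intro sum_mono) force
  also have "\<dots> = (\<Sum>t\<in>?J \<inter> K. norm (a - b))"
    by (rule sum.inter_restrict[symmetric]) simp
  also have "\<dots> \<le> (\<Sum>t\<in>K. norm (a - b))"
    using K by (intro sum_mono2) auto
  finally show ?thesis by (simp add: divide_right_mono mult_left_mono)
qed

lemma filtered_constant:
  fixes X :: "nat \<Rightarrow> real ^ 'p"
  assumes "\<theta> \<ge> 1" "\<And>t. t \<in> {i..i + \<theta> - 1} \<Longrightarrow> X t = b"
  shows "filtered \<theta> X i = b"
  using norm_filtered_diff_le[of \<theta> "{}" i X b b] assms by simp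

text \<open>A deterministic setting for one fixed realisation \<open>e\<close> of the noise:
  \<open>good\<close> is what holds outside the exceptional event, and \<open>B\<close> stands for
  the error level of one window.\<close>

locale noisy_series =
  fixes C :: "(real ^ 'p::finite) set" and lam :: real and n \<theta> :: nat and X e y :: "nat \<Rightarrow> real ^ 'p"
    and B :: real
  assumes body: "gauge_body C" and lam: "lam \<ge> 0" and \<theta>: "\<theta> \<ge> 1"
    and y: "\<And>t. t \<in> {1..n} \<Longrightarrow> y t = X t + e t"
    and sep: "\<And>s t. s \<in> change_points n X \<Longrightarrow> t \<in> change_points n X \<Longrightarrow> s \<noteq> t \<Longrightarrow> 4 * int \<theta> \<le> \<bar>int s - int t\<bar>"
    and good: "\<And>t. \<theta> \<le> t \<Longrightarrow> t \<le> n - \<theta> \<Longrightarrow>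
      infdist (filtered \<theta> e (t - \<theta> + 1)) ((\<lambda>v. lam *\<^sub>R v) ` subdifferential (minkowski_gauge C) (X t)) +
      infdist (filtered \<theta> e (t + 1)) ((\<lambda>v. lam *\<^sub>R v) ` subdifferential (minkowski_gauge C) (X (t + 1))) \<le> 2 * B"
begin

abbreviation "S \<equiv> diff_stat C \<theta> lam y"

text \<open>Each estimate is compared with the denoised value of the exact level plus the same
  noise. Nonexpansiveness charges the filtering bias, and \<open>denoise_error\<close> charges the
  noise. The reference levels are \<open>X t\<close> for the window ending at \<open>t\<close> and
  \<open>X (t + 1)\<close> for the one starting at \<open>t + 1\<close>.\<close>

lemma diff_stat_perturbation:
  assumes t: "\<theta> \<le> t" "t + \<theta> \<le> n"
  shows "norm ((denoise C lam (filtered \<theta> y (t + 1)) - denoise C lam (filtered \<theta> y (t - \<theta> + 1))) - (X (t + 1) - X t))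
    \<le> norm (filtered \<theta> X (t - \<theta> + 1) - X t) + norm (filtered \<theta> X (t + 1) - X (t + 1)) + 2 * B"
proof -
  have one: "norm (denoise C lam (filtered \<theta> y i) - x) \<le> norm (filtered \<theta> X i - x) +
      infdist (filtered \<theta> e i) ((\<lambda>v. lam *\<^sub>R v) ` subdifferential (minkowski_gauge C) x)"
    if i: "1 \<le> i" "i + \<theta> - 1 \<le> n" for i x
  proof -
    have eq: "filtered \<theta> y i = filtered \<theta> X i + filtered \<theta> e i"
      using i by (intro filtered_add y) auto
    have "norm (denoise C lam (filtered \<theta> y i) - denoise C lam (x + filtered \<theta> e i)) \<le> norm (filtered \<theta> X i - x)"
      using denoise_nonexpansive[OF body lam, of "filtered \<theta> y i" "x + filtered \<theta> e i"] by (simp add: eq)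
    moreover have "norm (denoise C lam (x + filtered \<theta> e i) - x)
        \<le> infdist (filtered \<theta> e i) ((\<lambda>v. lam *\<^sub>R v) ` subdifferential (minkowski_gauge C) x)"
      by (rule denoise_error[OF body lam])
    ultimately show ?thesis
      using norm_triangle_ineq[of "denoise C lam (filtered \<theta> y i) - denoise C lam (x + filtered \<theta> e i)"
          "denoise C lam (x + filtered \<theta> e i) - x"] by simp
  qed
  let ?r = "denoise C lam (filtered \<theta> y (t + 1))" and ?l = "denoise C lam (filtered \<theta> y (t - \<theta> + 1))"
  have "norm ((?r - ?l) - (X (t + 1) - X t)) \<le> norm (?r - X (t + 1)) + norm (?l - X t)"
    using norm_triangle_ineq4[of "?r - X (t + 1)" "?l - X t"] by (simp add: algebra_simps)
  moreover have "t \<le> n - \<theta>" using t by simp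
  ultimately show ?thesis
    using one[of "t + 1" "X (t + 1)"] one[of "t - \<theta> + 1" "X t"] good[OF t(1)] t \<theta> by simp
qed

lemma diff_stat_le:
  assumes t: "\<theta> \<le> t" "t + \<theta> \<le> n"
  shows "S t \<le> norm (X t - X (t + 1)) + norm (filtered \<theta> X (t - \<theta> + 1) - X t)
    + norm (filtered \<theta> X (t + 1) - X (t + 1)) + 2 * B"
  using diff_stat_perturbation[OF t]
    norm_triangle_ineq2[of "denoise C lam (filtered \<theta> y (t + 1)) - denoise C lam (filtered \<theta> y (t - \<theta> + 1))" "X (t + 1) - X t"]
  by (simp add: diff_stat_def norm_minus_commute)

lemma diff_stat_away:
  assumes t: "\<theta> \<le> t" "t + \<theta> \<le> n"
    and away: "\<And>s. s \<in> change_points n X \<Longrightarrow> int \<theta> \<le> \<bar>int t - int s\<bar>"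
  shows "S t \<le> 2 * B"
proof -
  \<comment> \<open>The two windows cover \<open>t - \<theta> + 1\<close> to
    \<open>t + \<theta>\<close>. A change inside this range occurs at an index less than \<theta>
    from \<open>t\<close>, which \<open>away\<close> excludes.\<close>
  have c: "X k = X (t - \<theta> + 1)" if "t - \<theta> + 1 \<le> k" "k \<le> t + \<theta>" for k
  proof (rule constant_between_change_points[where n = n])
    show "j \<notin> change_points n X" if "t - \<theta> + 1 \<le> j" "j < k" for j
      using away[of j] that \<open>k \<le> t + \<theta>\<close> t by auto
  qed (use that t in auto)
  have "filtered \<theta> X (t - \<theta> + 1) = X (t - \<theta> + 1)" "filtered \<theta> X (t + 1) = X (t - \<theta> + 1)"
    by (rule filtered_constant[OF \<theta> c]; use t \<theta> in auto; linarith)+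
  then show ?thesis using diff_stat_le[OF t] c[of t] c[of "t + 1"] t \<theta> by simp
qed

lemma constant_before:
  assumes s: "s \<in> change_points n X" and k: "1 \<le> k" "k \<le> s" "s < k + 4 * \<theta>"
  shows "X k = X s"
proof -
  have "s < n" using s by (simp add: change_points_def)
  moreover have "j \<notin> change_points n X" if "k \<le> j" "j < s" for j
    using sep[OF _ s, of j] that k by auto
  ultimately show ?thesis using constant_between_change_points[of k s n X] k by simp
qed

lemma constant_after:
  assumes s: "s \<in> change_points n X" and k: "s < k" "k \<le> s + 4 * \<theta>" "k \<le> n"
  shows "X k = X (s + 1)"
proof (rule constant_between_change_points[where n = n])
  show "j \<notin> change_points n X" if "s + 1 \<le> j" "j < k" for j
    using sep[OF _ s, of j] that k by auto
qed (use k in auto)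

text \<open>At a change-point the left window lies wholly before the jump and the right one wholly
  after it, so neither has a bias.\<close>

lemma diff_stat_at:
  assumes s: "s \<in> change_points n X" and t: "\<theta> \<le> s" "s + \<theta> \<le> n"
  shows "S s \<ge> norm (X s - X (s + 1)) - 2 * B"
proof -
  have "filtered \<theta> X (s - \<theta> + 1) = X s" "filtered \<theta> X (s + 1) = X (s + 1)"
    by (rule filtered_constant[OF \<theta> constant_before[OF s]]; use t \<theta> in auto)
       (rule filtered_constant[OF \<theta> constant_after[OF s]]; use t \<theta> in auto)
  then show ?thesis
    using diff_stat_perturbation[OF t]
      norm_triangle_ineq2[of "X (s + 1) - X s" "denoise C lam (filtered \<theta> y (s + 1)) - denoise C lam (filtered \<theta> y (s - \<theta> + 1))"]
    by (simp add: diff_stat_def norm_minus_commute)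
qed

text \<open>Next to the change-point the signal is constant from \<open>t\<close> to
  \<open>t + 1\<close>, and only the window on the side of \<open>s\<close> straddles the jump. That
  window contains \<theta> minus the distance from \<open>t\<close> to \<open>s\<close> samples of
  the other level, and its bias is all that remains of the jump.\<close>

lemma diff_stat_near:
  assumes s: "s \<in> change_points n X" and t: "\<theta> \<le> t" "t + \<theta> \<le> n"
    and ts: "t \<noteq> s" "\<bar>int t - int s\<bar> < int \<theta>"
  shows "S t \<le> (1 - \<bar>real t - real s\<bar> / \<theta>) * norm (X s - X (s + 1)) + 2 * B"
proof (cases "s < t")
  case True
  have X: "X t = X (s + 1)" "X (t + 1) = X (s + 1)"
    by (rule constant_after[OF s]; use True ts t \<theta> in linarith)+
  have R: "filtered \<theta> X (t + 1) = X (s + 1)"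
    by (rule filtered_constant[OF \<theta> constant_after[OF s]]; use True ts t \<theta> in auto)
  have "norm (filtered \<theta> X (t - \<theta> + 1) - X (s + 1)) \<le> card {t - \<theta> + 1..s} / \<theta> * norm (X s - X (s + 1))"
  proof (rule norm_filtered_diff_le[OF \<theta>])
    fix k assume k: "k \<in> {t - \<theta> + 1..t - \<theta> + 1 + \<theta> - 1}"
    show "X k = X (s + 1) \<or> k \<in> {t - \<theta> + 1..s} \<and> X k = X s"
    proof (cases "k \<le> s")
      case True
      then have "X k = X s" using k ts t \<theta> \<open>s < t\<close> by (intro constant_before[OF s]) auto
      then show ?thesis using True k by simp
    next
      case False
      then have "X k = X (s + 1)" using k ts t \<theta> \<open>s < t\<close> by (intro constant_after[OF s]) auto
      then show ?thesis by simp
    qed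
  qed simp
  moreover have "card {t - \<theta> + 1..s} / \<theta> = 1 - \<bar>real t - real s\<bar> / \<theta>"
    using True ts t \<theta> by (simp add: of_nat_diff field_simps)
  ultimately have "norm (filtered \<theta> X (t - \<theta> + 1) - X (s + 1)) \<le> (1 - \<bar>real t - real s\<bar> / \<theta>) * norm (X s - X (s + 1))"
    by (simp only:)
  then show ?thesis using diff_stat_le[OF t] X R by simp
next
  case False
  with ts have lt: "t < s" by simp
  have "s < n" using s by (simp add: change_points_def)
  have X: "X t = X s" "X (t + 1) = X s"
    by (rule constant_before[OF s]; use lt ts t \<theta> in linarith)+
  have L: "filtered \<theta> X (t - \<theta> + 1) = X s"
    by (rule filtered_constant[OF \<theta> constant_before[OF s]]; use lt ts t \<theta> in auto)
  have "norm (filtered \<theta> X (t + 1) - X s) \<le> card {s + 1..t + \<theta>} / \<theta> * norm (X (s + 1) - X s)"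
  proof (rule norm_filtered_diff_le[OF \<theta>])
    fix k assume k: "k \<in> {t + 1..t + 1 + \<theta> - 1}"
    show "X k = X s \<or> k \<in> {s + 1..t + \<theta>} \<and> X k = X (s + 1)"
    proof (cases "k \<le> s")
      case True
      then have "X k = X s" using k ts t \<theta> lt by (intro constant_before[OF s]) auto
      then show ?thesis by simp
    next
      case False
      then have "X k = X (s + 1)" using k ts t \<theta> lt by (intro constant_after[OF s]) auto
      then show ?thesis using False k by simp
    qed
  qed simp
  moreover have "card {s + 1..t + \<theta>} / \<theta> = 1 - \<bar>real t - real s\<bar> / \<theta>"
    using lt ts t \<theta> by (simp add: of_nat_diff field_simps)
  ultimately have "norm (filtered \<theta> X (t + 1) - X s) \<le> (1 - \<bar>real t - real s\<bar> / \<theta>) * norm (X s - X (s + 1))"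
    by (simp only: norm_minus_commute)
  then show ?thesis using diff_stat_le[OF t] X L by (simp add: norm_minus_commute)
qed

lemma algorithm_output_accurate:
  assumes edge: "\<And>s. s \<in> change_points n X \<Longrightarrow> \<theta> \<le> s \<and> s + \<theta> \<le> n"
    and jump: "\<And>s. s \<in> change_points n X \<Longrightarrow> \<Delta> \<le> norm (X s - X (s + 1))"
    and \<gamma>: "2 * B < \<gamma>" "\<gamma> \<le> \<Delta> / 2" and B: "B > 0"
    and out: "is_algorithm_output n C \<theta> \<gamma> lam y T"
  shows "card T = card (change_points n X) \<and> (\<forall>i < card (change_points n X).
      \<bar>real (sorted_list_of_set T ! i) - real (sorted_list_of_set (change_points n X) ! i)\<bar> \<le> min (4 * B * \<theta> / \<Delta>) \<theta>)"
proof -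
  define S' where "S' = thresholded \<gamma> S"
  define A where "A = nonzero_indices n \<theta> S'"
  have \<gamma>0: "\<gamma> > 0" and \<Delta>0: "\<Delta> > 0" using \<gamma> B by auto
  have A_iff: "t \<in> A \<longleftrightarrow> \<theta> \<le> t \<and> t \<le> n - \<theta> \<and> \<gamma> \<le> S t" for t
    using \<gamma>0 by (auto simp: A_def nonzero_indices_def S'_def thresholded_def)
  have S'_A: "S' t = S t" if "t \<in> A" for t
    using that unfolding A_iff by (simp add: S'_def thresholded_def)
  show ?thesis
  proof (rule selection_near_change_points[where A = A and \<theta> = \<theta> and S = S'])
    show "is_selection S' (index_groups \<theta> A) T"
      using out by (simp add: is_algorithm_output_def Let_def A_def S'_def)
    show "finite A" by (rule finite_subset[of _ "{..n - \<theta>}"]) (auto simp: A_iff)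
    show sub: "change_points n X \<subseteq> A"
    proof
      fix s assume s: "s \<in> change_points n X"
      \<comment> \<open>The jump is at least \<open>2 * \<gamma>\<close>, and the loss
        \<open>2 * B\<close> is less than \<gamma>.\<close>
      have "\<gamma> \<le> S s" using diff_stat_at[OF s] edge[OF s] jump[OF s] \<gamma> by auto
      then show "s \<in> A" using edge[OF s] by (auto simp: A_iff)
    qed
    show "\<exists>s\<in>change_points n X. \<bar>int t - int s\<bar> < int \<theta>" if "t \<in> A" for t
    proof (rule ccontr)
      assume "\<not> ?thesis"
      \<comment> \<open>If \<open>n < \<theta>\<close>, truncated subtraction would give
        \<open>n - \<theta> = 0\<close>, contradicting
        \<open>1 \<le> \<theta> \<le> t \<le> n - \<theta>\<close>. So
        \<open>t \<le> n - \<theta>\<close> does mean \<open>t + \<theta> \<le> n\<close>.\<close>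
      moreover from that have "n \<ge> \<theta>" using \<theta> by (auto simp: A_iff)
      ultimately have "S t \<le> 2 * B" using that by (intro diff_stat_away) (auto simp: A_iff)
      then show False using that \<gamma> by (simp add: A_iff)
    qed
    show "3 * int \<theta> \<le> \<bar>int s - int t\<bar>" if "s \<in> change_points n X" "t \<in> change_points n X" "s \<noteq> t" for s t
      using sep[OF that] by simp
    show "\<bar>real t - real s\<bar> \<le> min (4 * B * \<theta> / \<Delta>) \<theta>"
      if s: "s \<in> change_points n X" and tA: "t \<in> A" and ts: "\<bar>int t - int s\<bar> < int \<theta>" and le: "S' s \<le> S' t" for s t
    proof -
      have "\<bar>real t - real s\<bar> \<le> \<theta>" using ts by linarith
      moreover have "\<bar>real t - real s\<bar> \<le> 4 * B * \<theta> / \<Delta>"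
      proof (cases "t = s")
        case True
        then show ?thesis using B \<Delta>0 by simp
      next
        case False
        have t: "\<theta> \<le> t" "t + \<theta> \<le> n" using tA \<theta> by (auto simp: A_iff)
        let ?D = "norm (X s - X (s + 1))" and ?\<delta> = "\<bar>real t - real s\<bar>"
        have sA: "s \<in> A" using sub s by blast
        \<comment> \<open>The maximiser beats the change-point: the lower bound at \<open>s\<close>
          meets the upper bound at \<open>t\<close>, and \<open>?D\<close> cancels except for the
          fraction lost by the displacement.\<close>
        have "?D - 2 * B \<le> (1 - ?\<delta> / \<theta>) * ?D + 2 * B"
          using diff_stat_at[OF s] edge[OF s] diff_stat_near[OF s t False ts] le S'_A[OF sA] S'_A[OF tA] by simp
        then have "?\<delta> / \<theta> * ?D \<le> 4 * B" by (simp add: algebra_simps)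
        moreover have "?\<delta> / \<theta> * \<Delta> \<le> ?\<delta> / \<theta> * ?D" using jump[OF s] by (intro mult_left_mono) auto
        ultimately have "?\<delta> / \<theta> * \<Delta> \<le> 4 * B" by linarith
        then show ?thesis using \<theta> \<Delta>0 by (simp add: field_simps)
      qed
      ultimately show ?thesis by simp
    qed
  qed
qed

end

subsection \<open>Measurability and the probability bound\<close>

lemma index_groups_subset:
  assumes "g \<in> index_groups \<theta> A"
  shows "g \<subseteq> A"
proof
  fix y assume y: "y \<in> g"
  define R where "R = close_consecutive \<theta> A \<union> (close_consecutive \<theta> A)\<inverse>"
  obtain x where x: "x \<in> A" "g = R\<^sup>* `` {x}"
    using assms unfolding index_groups_def R_def[symmetric] by (auto simp: quotient_def)
  then have "(x, y) \<in> R\<^sup>*" using y by auto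
  then show "y \<in> A" using x(1)
    by (induction rule: rtrancl_induct) (auto simp: R_def close_consecutive_def)
qed

text \<open>Grouping looks only at which values vanish, and selection only at their order within a
  group. Equal zero patterns and equal strict comparisons therefore admit the same outputs.\<close>

lemma is_algorithm_output_cong:
  fixes y y' :: "nat \<Rightarrow> real ^ 'p" and C :: "(real ^ 'p) set" and \<theta> :: nat and lam \<gamma> :: real
  defines "S \<equiv> thresholded \<gamma> (diff_stat C \<theta> lam y)" and "S' \<equiv> thresholded \<gamma> (diff_stat C \<theta> lam y')"
  assumes zero: "\<And>t. t \<in> {\<theta>..n - \<theta>} \<Longrightarrow> S t \<noteq> 0 \<longleftrightarrow> S' t \<noteq> 0"
    and less: "\<And>s t. s \<in> {\<theta>..n - \<theta>} \<Longrightarrow> t \<in> {\<theta>..n - \<theta>} \<Longrightarrow> S s < S t \<longleftrightarrow> S' s < S' t"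
    and out: "is_algorithm_output n C \<theta> \<gamma> lam y T"
  shows "is_algorithm_output n C \<theta> \<gamma> lam y' T"
proof -
  let ?A = "nonzero_indices n \<theta> S"
  have A: "nonzero_indices n \<theta> S' = ?A"
    using zero by (auto simp: nonzero_indices_def)
  have sub: "g \<subseteq> {\<theta>..n - \<theta>}" if "g \<in> index_groups \<theta> ?A" for g
    using index_groups_subset[OF that] by (auto simp: nonzero_indices_def)
  obtain sel where sel: "\<And>g. g \<in> index_groups \<theta> ?A \<Longrightarrow> is_arg_max S (\<lambda>t. t \<in> g) (sel g)"
    and T: "T = sel ` index_groups \<theta> ?A"
    using out unfolding is_algorithm_output_def is_selection_def Let_def S_def[symmetric] by blast
  have "is_arg_max S' (\<lambda>t. t \<in> g) (sel g)" if g: "g \<in> index_groups \<theta> ?A" for g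
  proof -
    have "sel g \<in> g" and "\<not> S (sel g) < S t" if "t \<in> g" for t
      using sel[OF g] that by (auto simp: is_arg_max_def)
    moreover have "sel g \<in> g" using sel[OF g] by (auto simp: is_arg_max_def)
    ultimately have "\<not> S' (sel g) < S' t" if "t \<in> g" for t
      using less[of "sel g" t] sub[OF g] that by blast
    with \<open>sel g \<in> g\<close> show ?thesis by (auto simp: is_arg_max_def)
  qed
  then show ?thesis
    unfolding is_algorithm_output_def is_selection_def Let_def S'_def[symmetric] A using T by blast
qed

lemma borel_measurable_denoise:
  fixes C :: "(real ^ 'p::finite) set"
  assumes "gauge_body C" "lam \<ge> 0"
  shows "denoise C lam \<in> borel_measurable borel"
proof (rule borel_measurable_lipschitz)
  show "1-lipschitz_on UNIV (denoise C lam)"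
    by (rule lipschitz_onI) (auto simp: dist_norm denoise_nonexpansive[OF assms])
qed

text \<open>\<open>P\<close> is an arbitrary predicate, so measurability comes from the event being
  a finite union of classes on which the order pattern of the statistic is constant.\<close>

lemma algorithm_output_event_measurable:
  fixes Y :: "nat \<Rightarrow> 'w \<Rightarrow> real ^ 'p::finite"
  assumes C: "gauge_body C" and lam: "lam \<ge> 0" and \<theta>: "\<theta> \<ge> 1"
    and Y: "\<And>t. t \<in> {1..n} \<Longrightarrow> Y t \<in> borel_measurable M"
  shows "{\<omega> \<in> space M. \<forall>T. is_algorithm_output n C \<theta> \<gamma> lam (\<lambda>t. Y t \<omega>) T \<longrightarrow> P T} \<in> sets M"
proof -
  let ?I = "{\<theta>..n - \<theta>}"
  define v where "v t \<omega> = thresholded \<gamma> (diff_stat C \<theta> lam (\<lambda>t. Y t \<omega>)) t" for t \<omega>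
  have filt: "(\<lambda>\<omega>. filtered \<theta> (\<lambda>t. Y t \<omega>) i) \<in> borel_measurable M" if "1 \<le> i" "i + \<theta> - 1 \<le> n" for i
    unfolding filtered_def using that by (intro borel_measurable_scaleR borel_measurable_const borel_measurable_sum Y) auto
  have den: "(\<lambda>\<omega>. denoise C lam (filtered \<theta> (\<lambda>t. Y t \<omega>) i)) \<in> borel_measurable M"
    if "1 \<le> i" "i + \<theta> - 1 \<le> n" for i
    by (rule measurable_compose[OF filt[OF that] borel_measurable_denoise[OF C lam]])
  have v[measurable]: "v t \<in> borel_measurable M" if t: "t \<in> ?I" for t
  proof -
    have [measurable]: "(\<lambda>\<omega>. denoise C lam (filtered \<theta> (\<lambda>t. Y t \<omega>) (t + 1))) \<in> borel_measurable M"
      "(\<lambda>\<omega>. denoise C lam (filtered \<theta> (\<lambda>t. Y t \<omega>) (t - \<theta> + 1))) \<in> borel_measurable M"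
      using t \<theta> by (auto intro!: den)
    have [measurable]: "(\<lambda>\<omega>. diff_stat C \<theta> lam (\<lambda>t. Y t \<omega>) t) \<in> borel_measurable M"
      unfolding diff_stat_def by measurable
    show ?thesis unfolding v_def[abs_def] thresholded_def by measurable
  qed
  \<comment> \<open>The set of outputs depends only on finitely many comparisons between values of the statistic.\<close>
  define pat where "pat \<omega> = ({t \<in> ?I. v t \<omega> \<noteq> 0}, {(s, t) \<in> ?I \<times> ?I. v s \<omega> < v t \<omega>})" for \<omega>
  define E where "E = {\<omega> \<in> space M. \<forall>T. is_algorithm_output n C \<theta> \<gamma> lam (\<lambda>t. Y t \<omega>) T \<longrightarrow> P T}"
  have inv: "\<omega>' \<in> E" if "\<omega> \<in> E" "\<omega>' \<in> space M" "pat \<omega>' = pat \<omega>" for \<omega> \<omega>'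
  proof -
    have zero: "v t \<omega>' \<noteq> 0 \<longleftrightarrow> v t \<omega> \<noteq> 0" if "t \<in> ?I" for t
      using \<open>pat \<omega>' = pat \<omega>\<close> that unfolding pat_def by blast
    have less: "v s \<omega>' < v t \<omega>' \<longleftrightarrow> v s \<omega> < v t \<omega>" if "s \<in> ?I" "t \<in> ?I" for s t
      using \<open>pat \<omega>' = pat \<omega>\<close> that unfolding pat_def by blast
    have "P T" if "is_algorithm_output n C \<theta> \<gamma> lam (\<lambda>t. Y t \<omega>') T" for T
    proof -
      have "is_algorithm_output n C \<theta> \<gamma> lam (\<lambda>t. Y t \<omega>) T"
        by (rule is_algorithm_output_cong[OF _ _ that]) (use zero less in \<open>unfold v_def, blast+\<close>)
      then show ?thesis using \<open>\<omega> \<in> E\<close> by (simp add: E_def)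
    qed
    then show ?thesis using that by (simp add: E_def)
  qed
  have fib: "{\<omega> \<in> space M. pat \<omega> = pat \<omega>0} \<in> sets M" for \<omega>0
  proof -
    have "{\<omega> \<in> space M. pat \<omega> = pat \<omega>0}
      = {\<omega> \<in> space M. (\<forall>t\<in>?I. (v t \<omega> \<noteq> 0) = (v t \<omega>0 \<noteq> 0)) \<and> (\<forall>s\<in>?I. \<forall>t\<in>?I. (v s \<omega> < v t \<omega>) = (v s \<omega>0 < v t \<omega>0))}"
      unfolding pat_def by blast
    also have "\<dots> \<in> sets M" by measurable
    finally show ?thesis .
  qed
  have "finite (pat ` E)"
    by (rule finite_subset[of _ "Pow ?I \<times> Pow (?I \<times> ?I)"]) (auto simp: pat_def)
  then have "(\<Union>c\<in>pat ` E. {\<omega> \<in> space M. pat \<omega> = c}) \<in> sets M"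
    using fib by (intro sets.finite_UN) auto
  moreover have "(\<Union>c\<in>pat ` E. {\<omega> \<in> space M. pat \<omega> = c}) = E"
    using inv by (auto simp: E_def)
  ultimately show ?thesis by (simp add: E_def)
qed

section \<open>The probability bound and the final assembly\<close>

lemma infdist_scaleR_le:
  fixes x :: "'a::real_normed_vector"
  assumes a: "a > 0"
  shows "infdist (a *\<^sub>R x) ((\<lambda>v. a *\<^sub>R v) ` K) \<le> a * infdist x K"
proof (cases "K = {}")
  case False
  have "infdist (a *\<^sub>R x) ((\<lambda>v. a *\<^sub>R v) ` K) / a \<le> dist x k" if "k \<in> K" for k
  proof -
    have "infdist (a *\<^sub>R x) ((\<lambda>v. a *\<^sub>R v) ` K) \<le> dist (a *\<^sub>R x) (a *\<^sub>R k)"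
      using that by (intro infdist_le) auto
    also have "\<dots> = a * dist x k"
      using a by (simp add: dist_norm flip: scaleR_diff_right)
    finally show ?thesis using a by (simp add: field_simps)
  qed
  then have "infdist (a *\<^sub>R x) ((\<lambda>v. a *\<^sub>R v) ` K) / a \<le> infdist x K"
    using False by (auto simp: infdist_def[of x] intro!: cINF_greatest)
  then show ?thesis using a by (simp add: field_simps)
qed (simp add: infdist_def)

text \<open>The value at the minimiser bounds the family from below and belongs to it, so the
  infimum is attained there. This lets the tuning of \<open>lam\<close> control every mean distance
  by \<eta>.\<close>

lemma gaussian_dist_eq_minimum:
  assumes "is_arg_min (max_gaussian_dist C \<X>) (\<lambda>l. l \<ge> 0) l"
  shows "gaussian_dist C \<X> = max_gaussian_dist C \<X> l"
proof -
  have l: "l \<in> {0..}" and min: "max_gaussian_dist C \<X> l \<le> max_gaussian_dist C \<X> k" if "k \<in> {0..}" for k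
    using assms that by (auto simp: is_arg_min_def not_less)
  have "(INF k\<in>{0..}. max_gaussian_dist C \<X> k) \<le> max_gaussian_dist C \<X> l"
    using l[of 0] min by (intro cINF_lower bdd_belowI2) auto
  moreover have "max_gaussian_dist C \<X> l \<le> (INF k\<in>{0..}. max_gaussian_dist C \<X> k)"
    using min by (intro cINF_greatest) auto
  ultimately show ?thesis by (simp add: gaussian_dist_def)
qed

theorem theorem3p1:
  fixes M :: "'w measure"
    and X :: "nat \<Rightarrow> real ^ 'p"
    and \<epsilon> Y :: "nat \<Rightarrow> 'w \<Rightarrow> real ^ 'p"
    and C \<X> :: "(real ^ 'p) set"
    and \<tau> :: "nat set"
    and n \<theta> :: nat
    and \<sigma> r \<gamma> lam \<Delta>min Tmin \<eta> :: real
  assumes "prob_space M"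
    and "\<sigma> > 0"
    and "\<And>t. t \<in> {1..n} \<Longrightarrow> distributed M lborel (\<epsilon> t) (\<lambda>x. ennreal (iso_normal_density \<sigma> x))"
    and "prob_space.indep_vars M (\<lambda>_. borel) \<epsilon> {1..n}"
    and "\<And>t \<omega>. t \<in> {1..n} \<Longrightarrow> \<omega> \<in> space M \<Longrightarrow> Y t \<omega> = X t + \<epsilon> t \<omega>"
    and "\<tau> = change_points n X"
    and "card \<tau> \<ge> 2"
    and "\<Delta>min = min_jump n X"
    and "Tmin = min_spacing n X"
    and "\<X> = X ` {1..n}"
    and "r > 1"
    and "convex C"
    and "0 \<in> interior C"
    and "\<eta> = gaussian_dist C \<X>"
    and "\<Delta>min\<^sup>2 * Tmin \<ge> 64 * \<sigma>\<^sup>2 * (\<eta> + r * sqrt (2 * ln (real n)))\<^sup>2"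
    and "\<And>t. t \<in> \<tau> \<Longrightarrow> Tmin / 4 \<le> real t \<and> real t \<le> real n - Tmin / 4"
    and "\<theta> \<ge> 1"
    and "Tmin / 4 \<ge> real \<theta>"
    and "\<Delta>min / 2 \<ge> \<gamma>"
    and "\<gamma> \<ge> 2 * (\<sigma> / sqrt (real \<theta>)) * (\<eta> + r * sqrt (2 * ln (real n)))"
    and "\<exists>l. is_arg_min (max_gaussian_dist C \<X>) (\<lambda>l. l \<ge> 0) l \<and> lam = \<sigma> / sqrt (real \<theta>) * l"
  shows "measure M {\<omega> \<in> space M. \<forall>\<tau>hat. is_algorithm_output n C \<theta> \<gamma> lam (\<lambda>t. Y t \<omega>) \<tau>hat \<longrightarrow>
            card \<tau>hat = card \<tau> \<and>
            (\<forall>i < card \<tau>.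
               \<bar>real (sorted_list_of_set \<tau>hat ! i) - real (sorted_list_of_set \<tau> ! i)\<bar>
               \<le> min ((4 * r * sqrt (ln (real n)) / \<eta> + 4) * (\<sigma> * \<eta> / \<Delta>min) * sqrt (real \<theta>))
                     (real \<theta>))}
         > 1 - 5 * real n powr (1 - r\<^sup>2)"
proof -
  note \<sigma> = \<open>\<sigma> > 0\<close> and \<theta> = \<open>\<theta> \<ge> 1\<close> and \<tau> = \<open>\<tau> = change_points n X\<close>
  note noise = assms(3) and indep = assms(4) and Yeq = assms(5) and edge = assms(16)
  interpret prob_space M by fact
  have C: "gauge_body C" using assms by unfold_locales
  interpret gauge_body C by fact
  have fin\<tau>: "finite \<tau>" unfolding \<tau> by (rule finite_change_points)
  have "\<not> \<tau> \<subseteq> {}" using \<open>card \<tau> \<ge> 2\<close> by auto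
  then have n2: "n \<ge> 2" by (auto simp: \<tau> change_points_def)
  have lnn: "ln (real n) > 0" using n2 by simp
  define c where "c = \<sigma> / sqrt \<theta>"
  have c: "c > 0" using \<sigma> \<theta> by (simp add: c_def)
  obtain l where l: "is_arg_min (max_gaussian_dist C \<X>) (\<lambda>l. l \<ge> 0) l" and lam_eq: "lam = c * l"
    using assms(21) by (auto simp: c_def)
  have lam: "lam \<ge> 0" using l c by (simp add: lam_eq is_arg_min_def)
  \<comment> \<open>Scaled by \<open>l\<close> rather than \<open>lam\<close>: these sets belong to
    the standardised noise, and \<open>lam = c * l\<close> lets the factor \<open>c\<close> be
    pulled out of distances later.\<close>
  define K where "K x = (\<lambda>v. l *\<^sub>R v) ` subdifferential (minkowski_gauge C) x" for x
  have K: "bounded (K x)" "K x \<noteq> {}" for x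
  proof -
    have "bounded (subdifferential (minkowski_gauge C) x)"
      using subdifferential_gauge_bounded by (auto simp: bounded_iff)
    then show "bounded (K x)" unfolding K_def by (rule bounded_scaling)
    show "K x \<noteq> {}" using subdifferential_gauge_nonempty by (simp add: K_def)
  qed
  have \<eta>_ge: "(\<integral>g. infdist g (K (X t)) \<partial>std_gaussian) \<le> \<eta>" if "t \<in> {1..n}" for t
    unfolding \<open>\<eta> = gaussian_dist C \<X>\<close> gaussian_dist_eq_minimum[OF l] max_gaussian_dist_def K_def
    using that by (intro Max_ge) (auto simp: \<open>\<X> = X ` {1..n}\<close>)
  \<comment> \<open>Needed because the localisation bound divides by \<open>\<eta>\<close> and would collapse to \<open>0\<close> for \<open>\<eta> = 0\<close>.\<close>
  have \<eta>: "\<eta> > 0"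
    using \<eta>_ge[of 1] integral_infdist_std_gaussian_pos[OF K, of "X 1"] n2 by auto
  \<comment> \<open>There is no factor 2 under the root: the tail \<open>exp (- u\<^sup>2)\<close>
    already yields \<open>n powr (- r\<^sup>2)\<close>. The gap to \<open>sqrt (2 * ln n)\<close> in
    the hypothesis on \<gamma> makes \<open>2 * B < \<gamma>\<close> strict.\<close>
  define u where "u = r * sqrt (ln n)"
  have u: "u > 0" using \<open>r > 1\<close> lnn by (simp add: u_def)
  define B where "B = c * (\<eta> + u)"
  have B: "B > 0" using c \<eta> u by (simp add: B_def)
  have B\<gamma>: "2 * B < \<gamma>"
  proof -
    have "u < r * sqrt (2 * ln n)" using lnn \<open>r > 1\<close> by (simp add: u_def)
    then have "2 * c * (\<eta> + u) < 2 * c * (\<eta> + r * sqrt (2 * ln n))"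
      using c by (intro mult_strict_left_mono) auto
    then show ?thesis using assms(20) by (simp add: B_def c_def)
  qed
  have sep: "4 * int \<theta> \<le> \<bar>int s - int t\<bar>" if "s \<in> change_points n X" "t \<in> change_points n X" "s \<noteq> t" for s t
  proof -
    let ?D = "{\<bar>real s - real t\<bar> | s t. s \<in> change_points n X \<and> t \<in> change_points n X \<and> s \<noteq> t}"
    have "finite ?D"
      by (rule finite_subset[of _ "(\<lambda>(s, t). \<bar>real s - real t\<bar>) ` (\<tau> \<times> \<tau>)"]) (use fin\<tau> in \<open>auto simp: \<tau>\<close>)
    then have "Tmin \<le> \<bar>real s - real t\<bar>"
      unfolding \<open>Tmin = min_spacing n X\<close> min_spacing_def using that by (intro Min_le) auto
    then show ?thesis using \<open>Tmin / 4 \<ge> real \<theta>\<close> by linarith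
  qed
  have edge': "\<theta> \<le> s \<and> s + \<theta> \<le> n" if "s \<in> change_points n X" for s
    using edge[of s] that \<open>Tmin / 4 \<ge> real \<theta>\<close> unfolding \<tau> by linarith
  have jump: "\<Delta>min \<le> norm (X s - X (s + 1))" if "s \<in> change_points n X" for s
    unfolding \<open>\<Delta>min = min_jump n X\<close> min_jump_def using that finite_change_points by (intro Min_le) auto
  have \<Delta>: "\<Delta>min > 0" using B B\<gamma> \<open>\<Delta>min / 2 \<ge> \<gamma>\<close> by linarith
  have eps_meas: "\<epsilon> t \<in> borel_measurable M" if "t \<in> {1..n}" for t
    using indep that by (auto simp: indep_vars_def)
  have noise': "distr M borel (\<epsilon> t) = iso_gaussian \<sigma>" if "t \<in> {1..n}" for t
  proof -
    have "distr M borel (\<epsilon> t) = distr M lborel (\<epsilon> t)" by (rule distr_cong) auto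
    then show ?thesis
      using distributed_distr_eq_density[OF noise[OF that]] by (simp add: iso_gaussian_def)
  qed
  define Z where "Z i \<omega> = (sqrt \<theta> / \<sigma>) *\<^sub>R filtered \<theta> (\<lambda>t. \<epsilon> t \<omega>) i" for i \<omega>
  have Z_std: "distr M borel (Z i) = std_gaussian" if "1 \<le> i" "i + \<theta> - 1 \<le> n" for i
    unfolding Z_def
    by (intro filtered_noise_std_gaussian \<sigma> \<theta> noise' indep_vars_subset[OF indep]) (use that in auto)
  \<comment> \<open>The left window ends at \<open>t\<close> and is measured against the level
    \<open>X t\<close>, the right one starts at \<open>t + 1\<close> and is measured against
    \<open>X (t + 1)\<close>. The two share no noise vector.\<close>
  define W where "W t \<omega> = infdist (Z (t - \<theta> + 1) \<omega>) (K (X t)) + infdist (Z (t + 1) \<omega>) (K (X (t + 1)))" for t \<omega>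
  let ?I = "{\<theta>..n - \<theta>}"
  have tail: "prob {\<omega> \<in> space M. W t \<omega> > 2 * (\<eta> + u)} \<le> n powr (- r\<^sup>2)" and W_meas: "W t \<in> borel_measurable M"
    if t: "t \<in> ?I" for t
  proof -
    have win: "1 \<le> t - \<theta> + 1" "t - \<theta> + 1 + \<theta> - 1 \<le> n" "1 \<le> t + 1" "t + 1 + \<theta> - 1 \<le> n"
      using t \<theta> by auto
    have "indep_var borel (\<lambda>\<omega>. \<Sum>i\<in>{t - \<theta> + 1..t - \<theta> + 1 + \<theta> - 1}. \<epsilon> i \<omega>) borel (\<lambda>\<omega>. \<Sum>i\<in>{t + 1..t + 1 + \<theta> - 1}. \<epsilon> i \<omega>)"
      using t \<theta> by (intro indep_var_disjoint_sums[OF indep]) auto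
    then have "indep_var borel ((\<lambda>x. (sqrt \<theta> / \<sigma>) *\<^sub>R (1 / \<theta>) *\<^sub>R x) \<circ> (\<lambda>\<omega>. \<Sum>i\<in>{t - \<theta> + 1..t - \<theta> + 1 + \<theta> - 1}. \<epsilon> i \<omega>))
        borel ((\<lambda>x. (sqrt \<theta> / \<sigma>) *\<^sub>R (1 / \<theta>) *\<^sub>R x) \<circ> (\<lambda>\<omega>. \<Sum>i\<in>{t + 1..t + 1 + \<theta> - 1}. \<epsilon> i \<omega>))"
      by (rule indep_var_compose) simp_all
    then have ind: "indep_var borel (Z (t - \<theta> + 1)) borel (Z (t + 1))"
      unfolding Z_def[abs_def] filtered_def comp_def .
    have "prob {\<omega> \<in> space M. W t \<omega> > 2 * (\<eta> + u)} \<le> exp (- u\<^sup>2)"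
      unfolding W_def
      by (intro gaussian_pair_tail[OF ind] Z_std win lipschitz_infdist \<eta>_ge u) (use t \<theta> in auto)
    also have "- u\<^sup>2 = - r\<^sup>2 * ln n" using lnn by (simp add: u_def power_mult_distrib)
    also have "exp (- r\<^sup>2 * ln n) = n powr (- r\<^sup>2)" using n2 by (simp add: powr_def)
    finally show "prob {\<omega> \<in> space M. W t \<omega> > 2 * (\<eta> + u)} \<le> n powr (- r\<^sup>2)" .
    have [measurable]: "Z (t - \<theta> + 1) \<in> borel_measurable M" "Z (t + 1) \<in> borel_measurable M"
      using ind indep_var_rv1 indep_var_rv2 by blast+
    note [measurable] = borel_measurable_lipschitz[OF lipschitz_infdist]
    show "W t \<in> borel_measurable M" unfolding W_def by measurable
  qed
  define bad where "bad t = {\<omega> \<in> space M. W t \<omega> > 2 * (\<eta> + u)}" for t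
  have bad: "bad t \<in> sets M" if "t \<in> ?I" for t
    using W_meas[OF that] unfolding bad_def by measurable
  have "prob (\<Union>t\<in>?I. bad t) \<le> (\<Sum>t\<in>?I. prob (bad t))"
    using bad by (intro finite_measure_subadditive_finite) auto
  also have "\<dots> \<le> (\<Sum>t\<in>?I. n powr (- r\<^sup>2))"
    unfolding bad_def by (intro sum_mono tail)
  also have "\<dots> = card ?I * n powr (- r\<^sup>2)" by simp
  \<comment> \<open>Strict because fewer than \<open>n\<close> indices are tested, as
    \<open>\<theta> \<ge> 1\<close>.\<close>
  also have "\<dots> < n * n powr (- r\<^sup>2)"
    using n2 \<theta> by (intro mult_strict_right_mono) auto
  also have "\<dots> = n powr (1 - r\<^sup>2)"
    using n2 by (simp add: powr_diff powr_minus field_simps)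
  finally have bad_lt: "prob (\<Union>t\<in>?I. bad t) < n powr (1 - r\<^sup>2)" .
  let ?P = "\<lambda>\<tau>hat. card \<tau>hat = card \<tau> \<and>
            (\<forall>i < card \<tau>.
               \<bar>real (sorted_list_of_set \<tau>hat ! i) - real (sorted_list_of_set \<tau> ! i)\<bar>
               \<le> min ((4 * r * sqrt (ln (real n)) / \<eta> + 4) * (\<sigma> * \<eta> / \<Delta>min) * sqrt (real \<theta>))
                     (real \<theta>))"
  let ?E = "{\<omega> \<in> space M. \<forall>\<tau>hat. is_algorithm_output n C \<theta> \<gamma> lam (\<lambda>t. Y t \<omega>) \<tau>hat \<longrightarrow> ?P \<tau>hat}"
  \<comment> \<open>The stated localisation bound is \<open>4 * B * \<theta> / \<Delta>min\<close>
    with \<open>B\<close> written out; the division by \<eta> cancels.\<close>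
  have bound_eq: "(4 * r * sqrt (ln n) / \<eta> + 4) * (\<sigma> * \<eta> / \<Delta>min) * sqrt \<theta> = 4 * B * \<theta> / \<Delta>min"
  proof -
    have "(4 * r * sqrt (ln n) / \<eta> + 4) * (\<sigma> * \<eta> / \<Delta>min) * sqrt \<theta> = 4 * (\<eta> + u) * (\<sigma> * sqrt \<theta>) / \<Delta>min"
      using \<eta> \<Delta> by (simp add: u_def field_simps)
    moreover have "\<sigma> * sqrt \<theta> = c * \<theta>"
      using \<theta> by (simp add: c_def field_simps)
    ultimately show ?thesis by (simp add: B_def algebra_simps)
  qed
  \<comment> \<open>Each outcome outside the bad events gives its own instance of
    \<open>noisy_series\<close>, to which the deterministic analysis applies for every
    tie-breaking.\<close>
  have "space M - (\<Union>t\<in>?I. bad t) \<subseteq> ?E"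
  proof
    fix \<omega> assume \<omega>: "\<omega> \<in> space M - (\<Union>t\<in>?I. bad t)"
    interpret noisy_series C lam n \<theta> X "\<lambda>t. \<epsilon> t \<omega>" "\<lambda>t. Y t \<omega>" B
    proof
      show "infdist (filtered \<theta> (\<lambda>t. \<epsilon> t \<omega>) (t - \<theta> + 1)) ((\<lambda>v. lam *\<^sub>R v) ` subdifferential (minkowski_gauge C) (X t)) +
          infdist (filtered \<theta> (\<lambda>t. \<epsilon> t \<omega>) (t + 1)) ((\<lambda>v. lam *\<^sub>R v) ` subdifferential (minkowski_gauge C) (X (t + 1))) \<le> 2 * B"
        if t: "\<theta> \<le> t" "t \<le> n - \<theta>" for t
      proof -
        have one: "infdist (filtered \<theta> (\<lambda>t. \<epsilon> t \<omega>) i) ((\<lambda>v. lam *\<^sub>R v) ` subdifferential (minkowski_gauge C) x)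
            \<le> c * infdist (Z i \<omega>) (K x)" for i x
        proof -
          have "filtered \<theta> (\<lambda>t. \<epsilon> t \<omega>) i = c *\<^sub>R Z i \<omega>"
            using \<sigma> \<theta> by (simp add: Z_def c_def)
          moreover have "(\<lambda>v. lam *\<^sub>R v) ` subdifferential (minkowski_gauge C) x = (\<lambda>v. c *\<^sub>R v) ` K x"
            by (simp add: K_def image_image lam_eq)
          ultimately show ?thesis using infdist_scaleR_le[OF c] by simp
        qed
        have "W t \<omega> \<le> 2 * (\<eta> + u)" using \<omega> t by (force simp: bad_def not_less)
        then have "c * W t \<omega> \<le> 2 * B" using c by (simp add: B_def)
        then show ?thesis
          using one[of "t - \<theta> + 1" "X t"] one[of "t + 1" "X (t + 1)"] by (simp add: W_def distrib_left)
      qed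
    qed (use C lam \<theta> sep Yeq \<omega> in auto)
    show "\<omega> \<in> ?E"
      using algorithm_output_accurate[OF edge' jump B\<gamma> \<open>\<Delta>min / 2 \<ge> \<gamma>\<close> B] \<omega>
      unfolding bound_eq \<tau> by blast
  qed
  moreover have "?E \<in> sets M"
  proof (rule algorithm_output_event_measurable[OF C lam \<theta>])
    fix t assume t: "t \<in> {1..n}"
    have "(\<lambda>\<omega>. X t + \<epsilon> t \<omega>) \<in> borel_measurable M"
      using eps_meas[OF t] by measurable
    then show "Y t \<in> borel_measurable M"
      by (rule measurable_cong[THEN iffD1, rotated]) (use Yeq[OF t] in simp)
  qed
  ultimately have "prob (space M - (\<Union>t\<in>?I. bad t)) \<le> prob ?E"
    by (rule finite_measure_mono)
  moreover have "prob (space M - (\<Union>t\<in>?I. bad t)) = 1 - prob (\<Union>t\<in>?I. bad t)"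
    using bad by (intro prob_compl sets.finite_UN) auto
  moreover have "n powr (1 - r\<^sup>2) \<le> 5 * n powr (1 - r\<^sup>2)" by simp
  ultimately show ?thesis using bad_lt by linarith
qed

end
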